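(* For every simple proposition $S:\mathsf{SP}$ and every $r:\mathsf{Cr}(S)$, if $\mathsf{MR}(S,r)$ holds (is inhabited), then $\mathsf{Tp}(S)$ holds (is inhabited).
   Context: Setting: Martin-Löf constructive type theory with universes $\mathsf{Set}$, $\mathsf{Type},\dots$ closed under $\Pi,\Sigma,+,\times,\to$, the empty type $\emptyset$, the one-element type $\mathsf{Un}$ (with element $\mathbf{elt}$), and inductive types. A small type is a member of $\mathsf{Set}$. For small types, propositions are identified with types: a small proposition is true iff it is inhabited, $\land,\lor,\bot$ are used interchangeably with $\times,+,\emptyset$, and "there is" is $\Sigma$. Projections of a pair $r$ are written $r.1$, $r.2$; the injections into $A+B$ are $\mathsf{inl},\mathsf{inr}$. Simple propositions: $\mathsf{SP}$ is the inductive type generated by: $\bot:\mathsf{SP}$; $\mathsf{atom}(A):\mathsf{SP}$ for each small type $A$; $P\land Q$, $P\lor Q$, $P\to Q:\mathsf{SP}$ for $P,Q:\mathsf{SP}$; and $\forall(A,P)$, $\exists(A,P):\mathsf{SP}$ for each small type $A$ and each $P:A\to\mathsf{SP}$. $\mathsf{Tp}:\mathsf{SP}\to\mathsf{Set}$ is defined by recursion: $\mathsf{Tp}(\bot)=\emptyset$, $\mathsf{Tp}(\mathsf{atom}(A))=A$, $\mathsf{Tp}(P\land Q)=\mathsf{Tp}(P)\times\mathsf{Tp}(Q)$, $\mathsf{Tp}(P\lor Q)=\mathsf{Tp}(P)+\mathsf{Tp}(Q)$, $\mathsf{Tp}(P\to Q)=\mathsf{Tp}(P)\to\mathsf{Tp}(Q)$,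 $\mathsf{Tp}(\forall(A,P))=(\Pi x:A)\mathsf{Tp}(P(x))$, $\mathsf{Tp}(\exists(A,P))=(\Sigma x:A)\mathsf{Tp}(P(x))$. $\mathsf{Cr}:\mathsf{SP}\to\mathsf{Set}$ (crude type): $\mathsf{Cr}(\bot)=\mathsf{Un}$, $\mathsf{Cr}(\mathsf{atom}(A))=\mathsf{Un}$, $\mathsf{Cr}(P\land Q)=\mathsf{Cr}(P)\times\mathsf{Cr}(Q)$, $\mathsf{Cr}(P\lor Q)=\mathsf{Cr}(P)+\mathsf{Cr}(Q)$, $\mathsf{Cr}(P\to Q)=\mathsf{Cr}(P)\to\mathsf{Cr}(Q)$, $\mathsf{Cr}(\forall(A,P))=(\Pi x:A)\mathsf{Cr}(P(x))$, $\mathsf{Cr}(\exists(A,P))=(\Sigma x:A)\mathsf{Cr}(P(x))$. Modified realisability (with truth): for $S:\mathsf{SP}$ and $r:\mathsf{Cr}(S)$ the small proposition $\mathsf{MR}(S,r)$ is defined by recursion on $S$: $\mathsf{MR}(\bot,r)=\bot$; $\mathsf{MR}(\mathsf{atom}(P),r)=P$; $\mathsf{MR}(A\land B,r)=\mathsf{MR}(A,r.1)\land\mathsf{MR}(B,r.2)$; $\mathsf{MR}(A\lor B,\mathsf{inl}(s))=\mathsf{MR}(A,s)$; $\mathsf{MR}(A\lor B,\mathsf{inr}(t))=\mathsf{MR}(B,t)$; $\mathsf{MR}(A\to B,r)=(\mathsf{Tp}(A)\to\mathsf{Tp}(B))\land(\Pi s:\mathsf{Cr}(A))(\mathsf{MR}(A,s)\to\mathsf{MR}(B,r(s)))$;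 $\mathsf{MR}(\forall(A,P),r)=(\Pi x:A)\mathsf{MR}(P(x),r(x))$; $\mathsf{MR}(\exists(A,P),r)=\mathsf{MR}(P(r.1),r.2)$. *)

theory Defs
  imports Main
begin

text \<open>
  Intensional Martin-Loef type theory with a cumulative hierarchy of universes a la Russell and
  typed judgemental equality, deeply embedded with de Bruijn indices and given by its rules of
  inference.  \<open>Set\<close> and \<open>Type\<close> are the first two universes.  Non-dependent
  \<open>\<rightarrow>\<close> and \<open>\<times>\<close> are, as usual, the constant instances of \<open>\<Pi>\<close> and \<open>\<Sigma>\<close>; general inductive
  types are represented by \<open>W\<close>-types, and \<open>SP\<close> is an inductive type in \<open>Type\<close>.  Propositions are
  types, so a statement of the theory holds when its type has a term in the empty context.
  Quantifiers over \<open>SP\<close> and over small types are \<open>\<Pi>\<close>-types of the theory; hence a derivation is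
  uniform in them and remains one if further type formers are added.

  Eliminators are terms of \<open>\<Pi>\<close>-type: \<open>PlusRec c d\<close>, for example, is the function defined on
  \<open>A + B\<close> by the two cases \<open>c\<close> and \<open>d\<close>, and it binds one variable in each of them.  An
  eliminator does not record its motive; the typing rules quantify over it.
\<close>

section \<open>Raw terms and substitution\<close>

text \<open>
  Binding: \<open>Pi\<close>, \<open>Sig\<close>, \<open>W\<close> bind one variable in the second argument and \<open>Lam\<close> one.
  \<open>WRec\<close> binds \<open>a, f, h\<close>.  The cases of \<open>SPRec\<close> bind, in this order,
  \<^item> nothing for \<open>SBot\<close> and \<open>A\<close> for \<open>SAtom A\<close>,
  \<^item> \<open>P, Q, p, q\<close> for \<open>SAnd P Q\<close>, \<open>SOr P Q\<close>, \<open>SImp P Q\<close>,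
  \<^item> \<open>A, P, p\<close> for \<open>SAll A P\<close>, \<open>SEx A P\<close>,

  where the lower case letters are the values of the function at the immediate subtrees.
  The variable bound last has index 0.
\<close>

datatype tm =
    Var nat
  | Univ nat
  | Pi tm tm | Lam tm | App tm tm
  | Sig tm tm | Pair tm tm | Fst tm | Snd tm
  | Empty | EmptyRec
  | Unit | Elt | UnitRec tm
  | Plus tm tm | InL tm | InR tm | PlusRec tm tm
  | W tm tm | WSup tm tm | WRec tm
  | SP | SBot | SAtom tm | SAnd tm tm | SOr tm tm | SImp tm tm | SAll tm tm | SEx tm tm
  | SPRec tm tm tm tm tm tm tm

definition up_ren :: "(nat \<Rightarrow> nat) \<Rightarrow> nat \<Rightarrow> nat" where
  "up_ren \<rho> n = (case n of 0 \<Rightarrow> 0 | Suc m \<Rightarrow> Suc (\<rho> m))"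

primrec ren :: "(nat \<Rightarrow> nat) \<Rightarrow> tm \<Rightarrow> tm" where
  "ren \<rho> (Var n) = Var (\<rho> n)"
| "ren \<rho> (Univ i) = Univ i"
| "ren \<rho> (Pi A B) = Pi (ren \<rho> A) (ren (up_ren \<rho>) B)"
| "ren \<rho> (Lam t) = Lam (ren (up_ren \<rho>) t)"
| "ren \<rho> (App t u) = App (ren \<rho> t) (ren \<rho> u)"
| "ren \<rho> (Sig A B) = Sig (ren \<rho> A) (ren (up_ren \<rho>) B)"
| "ren \<rho> (Pair t u) = Pair (ren \<rho> t) (ren \<rho> u)"
| "ren \<rho> (Fst t) = Fst (ren \<rho> t)"
| "ren \<rho> (Snd t) = Snd (ren \<rho> t)"
| "ren \<rho> Empty = Empty"
| "ren \<rho> EmptyRec = EmptyRec"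
| "ren \<rho> Unit = Unit"
| "ren \<rho> Elt = Elt"
| "ren \<rho> (UnitRec c) = UnitRec (ren \<rho> c)"
| "ren \<rho> (Plus A B) = Plus (ren \<rho> A) (ren \<rho> B)"
| "ren \<rho> (InL t) = InL (ren \<rho> t)"
| "ren \<rho> (InR t) = InR (ren \<rho> t)"
| "ren \<rho> (PlusRec c d) = PlusRec (ren (up_ren \<rho>) c) (ren (up_ren \<rho>) d)"
| "ren \<rho> (W A B) = W (ren \<rho> A) (ren (up_ren \<rho>) B)"
| "ren \<rho> (WSup t u) = WSup (ren \<rho> t) (ren \<rho> u)"
| "ren \<rho> (WRec c) = WRec (ren ((up_ren ^^ 3) \<rho>) c)"
| "ren \<rho> SP = SP"
| "ren \<rho> SBot = SBot"
| "ren \<rho> (SAtom A) = SAtom (ren \<rho> A)"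
| "ren \<rho> (SAnd P Q) = SAnd (ren \<rho> P) (ren \<rho> Q)"
| "ren \<rho> (SOr P Q) = SOr (ren \<rho> P) (ren \<rho> Q)"
| "ren \<rho> (SImp P Q) = SImp (ren \<rho> P) (ren \<rho> Q)"
| "ren \<rho> (SAll A P) = SAll (ren \<rho> A) (ren \<rho> P)"
| "ren \<rho> (SEx A P) = SEx (ren \<rho> A) (ren \<rho> P)"
| "ren \<rho> (SPRec b0 b1 b2 b3 b4 b5 b6) =
     SPRec (ren \<rho> b0) (ren (up_ren \<rho>) b1)
       (ren ((up_ren ^^ 4) \<rho>) b2) (ren ((up_ren ^^ 4) \<rho>) b3) (ren ((up_ren ^^ 4) \<rho>) b4)
       (ren ((up_ren ^^ 3) \<rho>) b5) (ren ((up_ren ^^ 3) \<rho>) b6)"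

abbreviation lift :: "tm \<Rightarrow> tm" where
  "lift t \<equiv> ren Suc t"

definition up :: "(nat \<Rightarrow> tm) \<Rightarrow> nat \<Rightarrow> tm" where
  "up \<sigma> n = (case n of 0 \<Rightarrow> Var 0 | Suc m \<Rightarrow> lift (\<sigma> m))"

primrec subst :: "(nat \<Rightarrow> tm) \<Rightarrow> tm \<Rightarrow> tm" where
  "subst \<sigma> (Var n) = \<sigma> n"
| "subst \<sigma> (Univ i) = Univ i"
| "subst \<sigma> (Pi A B) = Pi (subst \<sigma> A) (subst (up \<sigma>) B)"
| "subst \<sigma> (Lam t) = Lam (subst (up \<sigma>) t)"
| "subst \<sigma> (App t u) = App (subst \<sigma> t) (subst \<sigma> u)"
| "subst \<sigma> (Sig A B) = Sig (subst \<sigma> A) (subst (up \<sigma>) B)"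
| "subst \<sigma> (Pair t u) = Pair (subst \<sigma> t) (subst \<sigma> u)"
| "subst \<sigma> (Fst t) = Fst (subst \<sigma> t)"
| "subst \<sigma> (Snd t) = Snd (subst \<sigma> t)"
| "subst \<sigma> Empty = Empty"
| "subst \<sigma> EmptyRec = EmptyRec"
| "subst \<sigma> Unit = Unit"
| "subst \<sigma> Elt = Elt"
| "subst \<sigma> (UnitRec c) = UnitRec (subst \<sigma> c)"
| "subst \<sigma> (Plus A B) = Plus (subst \<sigma> A) (subst \<sigma> B)"
| "subst \<sigma> (InL t) = InL (subst \<sigma> t)"
| "subst \<sigma> (InR t) = InR (subst \<sigma> t)"
| "subst \<sigma> (PlusRec c d) = PlusRec (subst (up \<sigma>) c) (subst (up \<sigma>) d)"
| "subst \<sigma> (W A B) = W (subst \<sigma> A) (subst (up \<sigma>) B)"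
| "subst \<sigma> (WSup t u) = WSup (subst \<sigma> t) (subst \<sigma> u)"
| "subst \<sigma> (WRec c) = WRec (subst ((up ^^ 3) \<sigma>) c)"
| "subst \<sigma> SP = SP"
| "subst \<sigma> SBot = SBot"
| "subst \<sigma> (SAtom A) = SAtom (subst \<sigma> A)"
| "subst \<sigma> (SAnd P Q) = SAnd (subst \<sigma> P) (subst \<sigma> Q)"
| "subst \<sigma> (SOr P Q) = SOr (subst \<sigma> P) (subst \<sigma> Q)"
| "subst \<sigma> (SImp P Q) = SImp (subst \<sigma> P) (subst \<sigma> Q)"
| "subst \<sigma> (SAll A P) = SAll (subst \<sigma> A) (subst \<sigma> P)"
| "subst \<sigma> (SEx A P) = SEx (subst \<sigma> A) (subst \<sigma> P)"
| "subst \<sigma> (SPRec b0 b1 b2 b3 b4 b5 b6) =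
     SPRec (subst \<sigma> b0) (subst (up \<sigma>) b1)
       (subst ((up ^^ 4) \<sigma>) b2) (subst ((up ^^ 4) \<sigma>) b3) (subst ((up ^^ 4) \<sigma>) b4)
       (subst ((up ^^ 3) \<sigma>) b5) (subst ((up ^^ 3) \<sigma>) b6)"

text \<open>
  \<open>insts k us t\<close> is simultaneous instantiation: it replaces the variables \<open>0, \<dots>, length us - 1\<close> of \<open>t\<close> by the entries of \<open>us\<close>;
  these may use \<open>k\<close> new variables, by which the remaining variables of \<open>t\<close> are shifted.  So
  \<open>insts k [a] C\<close> is \<open>C(a)\<close> in a context that extends the one of \<open>C\<close> by \<open>k\<close> variables.
\<close>

definition insts :: "nat \<Rightarrow> tm list \<Rightarrow> tm \<Rightarrow> tm" where
  "insts k us = subst (\<lambda>n. if n < length us then us ! n else Var (n - length us + k))"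

abbreviation inst :: "tm \<Rightarrow> tm \<Rightarrow> tm" where
  "inst B a \<equiv> insts 0 [a] B"

abbreviation Fun :: "tm \<Rightarrow> tm \<Rightarrow> tm" where
  "Fun A B \<equiv> Pi A (lift B)"

abbreviation Prod :: "tm \<Rightarrow> tm \<Rightarrow> tm" where
  "Prod A B \<equiv> Sig A (lift B)"

abbreviation SET :: tm where
  "SET \<equiv> Univ 0"

abbreviation TYPE' :: tm where
  "TYPE' \<equiv> Univ 1"


section \<open>Judgements\<close>

text \<open>
  A context lists the types of the variables, the most recent one first.  The abbreviations
  spell out the contexts and types of the cases of an eliminator with motive \<open>C\<close>.  With named
  variables, the premise on the case \<open>b\<close> of \<open>SAnd\<close> is
  \<open>P : SP, Q : SP, p : C P, q : C Q \<turnstile> b : C (SAnd P Q)\<close>, and the one for \<open>SAll\<close> is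
  \<open>A : Set, P : A \<rightarrow> SP, p : (\<Pi> x : A) C (P x) \<turnstile> b : C (SAll A P)\<close>.
\<close>

type_synonym ctx = "tm list"

abbreviation wrec_ctx :: "ctx \<Rightarrow> tm \<Rightarrow> tm \<Rightarrow> tm \<Rightarrow> ctx" where
  "wrec_ctx \<Gamma> A B C \<equiv>
     Pi (lift B) (insts 3 [App (Var 1) (Var 0)] C) # Fun B (lift (W A B)) # A # \<Gamma>"

abbreviation wrec_type :: "tm \<Rightarrow> tm" where
  "wrec_type C \<equiv> insts 3 [WSup (Var 2) (Var 1)] C"

abbreviation sp_ctx_bin :: "ctx \<Rightarrow> tm \<Rightarrow> ctx" where
  "sp_ctx_bin \<Gamma> C \<equiv> insts 3 [Var 1] C # insts 2 [Var 1] C # SP # SP # \<Gamma>"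

abbreviation sp_type_bin :: "(tm \<Rightarrow> tm \<Rightarrow> tm) \<Rightarrow> tm \<Rightarrow> tm" where
  "sp_type_bin con C \<equiv> insts 4 [con (Var 3) (Var 2)] C"

abbreviation sp_ctx_quant :: "ctx \<Rightarrow> tm \<Rightarrow> ctx" where
  "sp_ctx_quant \<Gamma> C \<equiv>
     Pi (Var 1) (insts 3 [App (Var 1) (Var 0)] C) # Fun (Var 0) SP # SET # \<Gamma>"

abbreviation sp_type_quant :: "(tm \<Rightarrow> tm \<Rightarrow> tm) \<Rightarrow> tm \<Rightarrow> tm" where
  "sp_type_quant con C \<equiv> insts 3 [con (Var 2) (Var 1)] C"

text \<open>
  The premises on the seven cases; \<open>J\<close> is instantiated with the typing judgement.
\<close>

abbreviation sp_cases ::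
  "(ctx \<Rightarrow> tm \<Rightarrow> tm \<Rightarrow> bool) \<Rightarrow> ctx \<Rightarrow> tm
    \<Rightarrow> tm \<Rightarrow> tm \<Rightarrow> tm \<Rightarrow> tm \<Rightarrow> tm \<Rightarrow> tm \<Rightarrow> tm \<Rightarrow> bool" where
  "sp_cases J \<Gamma> C b0 b1 b2 b3 b4 b5 b6 \<equiv>
     J \<Gamma> b0 (inst C SBot) \<and>
     J (SET # \<Gamma>) b1 (insts 1 [SAtom (Var 0)] C) \<and>
     J (sp_ctx_bin \<Gamma> C) b2 (sp_type_bin SAnd C) \<and>
     J (sp_ctx_bin \<Gamma> C) b3 (sp_type_bin SOr C) \<and>
     J (sp_ctx_bin \<Gamma> C) b4 (sp_type_bin SImp C) \<and>
     J (sp_ctx_quant \<Gamma> C) b5 (sp_type_quant SAll C) \<and>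
     J (sp_ctx_quant \<Gamma> C) b6 (sp_type_quant SEx C)"

inductive wf_ctx :: "ctx \<Rightarrow> bool"
  and has_type :: "ctx \<Rightarrow> tm \<Rightarrow> tm \<Rightarrow> bool"  ("_ \<turnstile> _ \<Colon> _" [51, 51, 51] 50)
  and eq_type :: "ctx \<Rightarrow> tm \<Rightarrow> tm \<Rightarrow> tm \<Rightarrow> bool"  ("_ \<turnstile> _ \<simeq> _ \<Colon> _" [51, 51, 51, 51] 50)
where
  wf_nil: "wf_ctx []"
| wf_cons: "\<Gamma> \<turnstile> A \<Colon> Univ i \<Longrightarrow> wf_ctx (A # \<Gamma>)"

  \<comment> \<open>variables, conversion, universes\<close>
| ty_var: "wf_ctx \<Gamma> \<Longrightarrow> n < length \<Gamma> \<Longrightarrow> \<Gamma> \<turnstile> Var n \<Colon> ren (\<lambda>m. m + Suc n) (\<Gamma> ! n)"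
| ty_conv: "\<Gamma> \<turnstile> t \<Colon> A \<Longrightarrow> \<Gamma> \<turnstile> A \<simeq> B \<Colon> Univ i \<Longrightarrow> \<Gamma> \<turnstile> t \<Colon> B"
| ty_univ: "wf_ctx \<Gamma> \<Longrightarrow> \<Gamma> \<turnstile> Univ i \<Colon> Univ (Suc i)"
| ty_cumul: "\<Gamma> \<turnstile> A \<Colon> Univ i \<Longrightarrow> \<Gamma> \<turnstile> A \<Colon> Univ (Suc i)"
| eq_refl: "\<Gamma> \<turnstile> t \<Colon> A \<Longrightarrow> \<Gamma> \<turnstile> t \<simeq> t \<Colon> A"
| eq_sym: "\<Gamma> \<turnstile> t \<simeq> u \<Colon> A \<Longrightarrow> \<Gamma> \<turnstile> u \<simeq> t \<Colon> A"
| eq_trans: "\<Gamma> \<turnstile> t \<simeq> u \<Colon> A \<Longrightarrow> \<Gamma> \<turnstile> u \<simeq> v \<Colon> A \<Longrightarrow> \<Gamma> \<turnstile> t \<simeq> v \<Colon> A"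
| eq_conv: "\<Gamma> \<turnstile> t \<simeq> u \<Colon> A \<Longrightarrow> \<Gamma> \<turnstile> A \<simeq> B \<Colon> Univ i \<Longrightarrow> \<Gamma> \<turnstile> t \<simeq> u \<Colon> B"
| eq_cumul: "\<Gamma> \<turnstile> A \<simeq> B \<Colon> Univ i \<Longrightarrow> \<Gamma> \<turnstile> A \<simeq> B \<Colon> Univ (Suc i)"

  \<comment> \<open>dependent functions\<close>
| ty_Pi: "\<Gamma> \<turnstile> A \<Colon> Univ i \<Longrightarrow> A # \<Gamma> \<turnstile> B \<Colon> Univ i \<Longrightarrow> \<Gamma> \<turnstile> Pi A B \<Colon> Univ i"
| ty_Lam: "\<Gamma> \<turnstile> A \<Colon> Univ i \<Longrightarrow> A # \<Gamma> \<turnstile> t \<Colon> B \<Longrightarrow> \<Gamma> \<turnstile> Lam t \<Colon> Pi A B"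
| ty_App: "\<Gamma> \<turnstile> t \<Colon> Pi A B \<Longrightarrow> \<Gamma> \<turnstile> u \<Colon> A \<Longrightarrow> \<Gamma> \<turnstile> App t u \<Colon> inst B u"
| eq_Pi: "\<Gamma> \<turnstile> A \<Colon> Univ i \<Longrightarrow> \<Gamma> \<turnstile> A \<simeq> A' \<Colon> Univ i \<Longrightarrow> A # \<Gamma> \<turnstile> B \<simeq> B' \<Colon> Univ i
    \<Longrightarrow> \<Gamma> \<turnstile> Pi A B \<simeq> Pi A' B' \<Colon> Univ i"
| eq_Lam: "\<Gamma> \<turnstile> A \<Colon> Univ i \<Longrightarrow> A # \<Gamma> \<turnstile> t \<simeq> t' \<Colon> B \<Longrightarrow> \<Gamma> \<turnstile> Lam t \<simeq> Lam t' \<Colon> Pi A B"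
| eq_App: "\<Gamma> \<turnstile> t \<simeq> t' \<Colon> Pi A B \<Longrightarrow> \<Gamma> \<turnstile> u \<simeq> u' \<Colon> A \<Longrightarrow> \<Gamma> \<turnstile> App t u \<simeq> App t' u' \<Colon> inst B u"
| eq_beta: "\<Gamma> \<turnstile> A \<Colon> Univ i \<Longrightarrow> A # \<Gamma> \<turnstile> t \<Colon> B \<Longrightarrow> \<Gamma> \<turnstile> u \<Colon> A
    \<Longrightarrow> \<Gamma> \<turnstile> App (Lam t) u \<simeq> inst t u \<Colon> inst B u"
| eq_eta: "\<Gamma> \<turnstile> t \<Colon> Pi A B \<Longrightarrow> \<Gamma> \<turnstile> t \<simeq> Lam (App (lift t) (Var 0)) \<Colon> Pi A B"

  \<comment> \<open>dependent pairs\<close>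
| ty_Sig: "\<Gamma> \<turnstile> A \<Colon> Univ i \<Longrightarrow> A # \<Gamma> \<turnstile> B \<Colon> Univ i \<Longrightarrow> \<Gamma> \<turnstile> Sig A B \<Colon> Univ i"
| ty_Pair: "\<Gamma> \<turnstile> A \<Colon> Univ i \<Longrightarrow> A # \<Gamma> \<turnstile> B \<Colon> Univ i \<Longrightarrow> \<Gamma> \<turnstile> t \<Colon> A \<Longrightarrow> \<Gamma> \<turnstile> u \<Colon> inst B t
    \<Longrightarrow> \<Gamma> \<turnstile> Pair t u \<Colon> Sig A B"
| ty_Fst: "\<Gamma> \<turnstile> t \<Colon> Sig A B \<Longrightarrow> \<Gamma> \<turnstile> Fst t \<Colon> A"
| ty_Snd: "\<Gamma> \<turnstile> t \<Colon> Sig A B \<Longrightarrow> \<Gamma> \<turnstile> Snd t \<Colon> inst B (Fst t)"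
| eq_Sig: "\<Gamma> \<turnstile> A \<Colon> Univ i \<Longrightarrow> \<Gamma> \<turnstile> A \<simeq> A' \<Colon> Univ i \<Longrightarrow> A # \<Gamma> \<turnstile> B \<simeq> B' \<Colon> Univ i
    \<Longrightarrow> \<Gamma> \<turnstile> Sig A B \<simeq> Sig A' B' \<Colon> Univ i"
| eq_Pair: "\<Gamma> \<turnstile> A \<Colon> Univ i \<Longrightarrow> A # \<Gamma> \<turnstile> B \<Colon> Univ i \<Longrightarrow> \<Gamma> \<turnstile> t \<simeq> t' \<Colon> A \<Longrightarrow> \<Gamma> \<turnstile> u \<simeq> u' \<Colon> inst B t
    \<Longrightarrow> \<Gamma> \<turnstile> Pair t u \<simeq> Pair t' u' \<Colon> Sig A B"
| eq_Fst: "\<Gamma> \<turnstile> t \<simeq> t' \<Colon> Sig A B \<Longrightarrow> \<Gamma> \<turnstile> Fst t \<simeq> Fst t' \<Colon> A"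
| eq_Snd: "\<Gamma> \<turnstile> t \<simeq> t' \<Colon> Sig A B \<Longrightarrow> \<Gamma> \<turnstile> Snd t \<simeq> Snd t' \<Colon> inst B (Fst t)"
| eq_Fst_Pair: "\<Gamma> \<turnstile> A \<Colon> Univ i \<Longrightarrow> A # \<Gamma> \<turnstile> B \<Colon> Univ i \<Longrightarrow> \<Gamma> \<turnstile> t \<Colon> A \<Longrightarrow> \<Gamma> \<turnstile> u \<Colon> inst B t
    \<Longrightarrow> \<Gamma> \<turnstile> Fst (Pair t u) \<simeq> t \<Colon> A"
| eq_Snd_Pair: "\<Gamma> \<turnstile> A \<Colon> Univ i \<Longrightarrow> A # \<Gamma> \<turnstile> B \<Colon> Univ i \<Longrightarrow> \<Gamma> \<turnstile> t \<Colon> A \<Longrightarrow> \<Gamma> \<turnstile> u \<Colon> inst B t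
    \<Longrightarrow> \<Gamma> \<turnstile> Snd (Pair t u) \<simeq> u \<Colon> inst B t"
| eq_Pair_eta: "\<Gamma> \<turnstile> t \<Colon> Sig A B \<Longrightarrow> \<Gamma> \<turnstile> t \<simeq> Pair (Fst t) (Snd t) \<Colon> Sig A B"

  \<comment> \<open>empty type\<close>
| ty_Empty: "wf_ctx \<Gamma> \<Longrightarrow> \<Gamma> \<turnstile> Empty \<Colon> SET"
| ty_EmptyRec: "Empty # \<Gamma> \<turnstile> C \<Colon> Univ i \<Longrightarrow> \<Gamma> \<turnstile> EmptyRec \<Colon> Pi Empty C"

  \<comment> \<open>one-element type\<close>
| ty_Unit: "wf_ctx \<Gamma> \<Longrightarrow> \<Gamma> \<turnstile> Unit \<Colon> SET"
| ty_Elt: "wf_ctx \<Gamma> \<Longrightarrow> \<Gamma> \<turnstile> Elt \<Colon> Unit"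
| ty_UnitRec: "Unit # \<Gamma> \<turnstile> C \<Colon> Univ i \<Longrightarrow> \<Gamma> \<turnstile> c \<Colon> inst C Elt \<Longrightarrow> \<Gamma> \<turnstile> UnitRec c \<Colon> Pi Unit C"
| eq_UnitRec: "Unit # \<Gamma> \<turnstile> C \<Colon> Univ i \<Longrightarrow> \<Gamma> \<turnstile> c \<simeq> c' \<Colon> inst C Elt
    \<Longrightarrow> \<Gamma> \<turnstile> UnitRec c \<simeq> UnitRec c' \<Colon> Pi Unit C"
| eq_UnitRec_Elt: "Unit # \<Gamma> \<turnstile> C \<Colon> Univ i \<Longrightarrow> \<Gamma> \<turnstile> c \<Colon> inst C Elt
    \<Longrightarrow> \<Gamma> \<turnstile> App (UnitRec c) Elt \<simeq> c \<Colon> inst C Elt"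

  \<comment> \<open>disjoint sums\<close>
| ty_Plus: "\<Gamma> \<turnstile> A \<Colon> Univ i \<Longrightarrow> \<Gamma> \<turnstile> B \<Colon> Univ i \<Longrightarrow> \<Gamma> \<turnstile> Plus A B \<Colon> Univ i"
| ty_InL: "\<Gamma> \<turnstile> A \<Colon> Univ i \<Longrightarrow> \<Gamma> \<turnstile> B \<Colon> Univ i \<Longrightarrow> \<Gamma> \<turnstile> t \<Colon> A \<Longrightarrow> \<Gamma> \<turnstile> InL t \<Colon> Plus A B"
| ty_InR: "\<Gamma> \<turnstile> A \<Colon> Univ i \<Longrightarrow> \<Gamma> \<turnstile> B \<Colon> Univ i \<Longrightarrow> \<Gamma> \<turnstile> t \<Colon> B \<Longrightarrow> \<Gamma> \<turnstile> InR t \<Colon> Plus A B"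
| ty_PlusRec: "Plus A B # \<Gamma> \<turnstile> C \<Colon> Univ i
    \<Longrightarrow> A # \<Gamma> \<turnstile> c \<Colon> insts 1 [InL (Var 0)] C \<Longrightarrow> B # \<Gamma> \<turnstile> d \<Colon> insts 1 [InR (Var 0)] C
    \<Longrightarrow> \<Gamma> \<turnstile> PlusRec c d \<Colon> Pi (Plus A B) C"
| eq_Plus: "\<Gamma> \<turnstile> A \<simeq> A' \<Colon> Univ i \<Longrightarrow> \<Gamma> \<turnstile> B \<simeq> B' \<Colon> Univ i \<Longrightarrow> \<Gamma> \<turnstile> Plus A B \<simeq> Plus A' B' \<Colon> Univ i"
| eq_InL: "\<Gamma> \<turnstile> A \<Colon> Univ i \<Longrightarrow> \<Gamma> \<turnstile> B \<Colon> Univ i \<Longrightarrow> \<Gamma> \<turnstile> t \<simeq> t' \<Colon> A \<Longrightarrow> \<Gamma> \<turnstile> InL t \<simeq> InL t' \<Colon> Plus A B"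
| eq_InR: "\<Gamma> \<turnstile> A \<Colon> Univ i \<Longrightarrow> \<Gamma> \<turnstile> B \<Colon> Univ i \<Longrightarrow> \<Gamma> \<turnstile> t \<simeq> t' \<Colon> B \<Longrightarrow> \<Gamma> \<turnstile> InR t \<simeq> InR t' \<Colon> Plus A B"
| eq_PlusRec: "Plus A B # \<Gamma> \<turnstile> C \<Colon> Univ i
    \<Longrightarrow> A # \<Gamma> \<turnstile> c \<simeq> c' \<Colon> insts 1 [InL (Var 0)] C
    \<Longrightarrow> B # \<Gamma> \<turnstile> d \<simeq> d' \<Colon> insts 1 [InR (Var 0)] C
    \<Longrightarrow> \<Gamma> \<turnstile> PlusRec c d \<simeq> PlusRec c' d' \<Colon> Pi (Plus A B) C"
| eq_PlusRec_InL: "Plus A B # \<Gamma> \<turnstile> C \<Colon> Univ i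
    \<Longrightarrow> A # \<Gamma> \<turnstile> c \<Colon> insts 1 [InL (Var 0)] C \<Longrightarrow> B # \<Gamma> \<turnstile> d \<Colon> insts 1 [InR (Var 0)] C \<Longrightarrow> \<Gamma> \<turnstile> t \<Colon> A
    \<Longrightarrow> \<Gamma> \<turnstile> App (PlusRec c d) (InL t) \<simeq> inst c t \<Colon> inst C (InL t)"
| eq_PlusRec_InR: "Plus A B # \<Gamma> \<turnstile> C \<Colon> Univ i
    \<Longrightarrow> A # \<Gamma> \<turnstile> c \<Colon> insts 1 [InL (Var 0)] C \<Longrightarrow> B # \<Gamma> \<turnstile> d \<Colon> insts 1 [InR (Var 0)] C \<Longrightarrow> \<Gamma> \<turnstile> t \<Colon> B
    \<Longrightarrow> \<Gamma> \<turnstile> App (PlusRec c d) (InR t) \<simeq> inst d t \<Colon> inst C (InR t)"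

  \<comment> \<open>well-founded trees\<close>
| ty_W: "\<Gamma> \<turnstile> A \<Colon> Univ i \<Longrightarrow> A # \<Gamma> \<turnstile> B \<Colon> Univ i \<Longrightarrow> \<Gamma> \<turnstile> W A B \<Colon> Univ i"
| ty_WSup: "\<Gamma> \<turnstile> A \<Colon> Univ i \<Longrightarrow> A # \<Gamma> \<turnstile> B \<Colon> Univ i \<Longrightarrow> \<Gamma> \<turnstile> t \<Colon> A \<Longrightarrow> \<Gamma> \<turnstile> u \<Colon> Fun (inst B t) (W A B)
    \<Longrightarrow> \<Gamma> \<turnstile> WSup t u \<Colon> W A B"
| ty_WRec: "W A B # \<Gamma> \<turnstile> C \<Colon> Univ i \<Longrightarrow> wrec_ctx \<Gamma> A B C \<turnstile> c \<Colon> wrec_type C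
    \<Longrightarrow> \<Gamma> \<turnstile> WRec c \<Colon> Pi (W A B) C"
| eq_W: "\<Gamma> \<turnstile> A \<Colon> Univ i \<Longrightarrow> \<Gamma> \<turnstile> A \<simeq> A' \<Colon> Univ i \<Longrightarrow> A # \<Gamma> \<turnstile> B \<simeq> B' \<Colon> Univ i
    \<Longrightarrow> \<Gamma> \<turnstile> W A B \<simeq> W A' B' \<Colon> Univ i"
| eq_WSup: "\<Gamma> \<turnstile> A \<Colon> Univ i \<Longrightarrow> A # \<Gamma> \<turnstile> B \<Colon> Univ i
    \<Longrightarrow> \<Gamma> \<turnstile> t \<simeq> t' \<Colon> A \<Longrightarrow> \<Gamma> \<turnstile> u \<simeq> u' \<Colon> Fun (inst B t) (W A B)
    \<Longrightarrow> \<Gamma> \<turnstile> WSup t u \<simeq> WSup t' u' \<Colon> W A B"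
| eq_WRec: "W A B # \<Gamma> \<turnstile> C \<Colon> Univ i \<Longrightarrow> wrec_ctx \<Gamma> A B C \<turnstile> c \<simeq> c' \<Colon> wrec_type C
    \<Longrightarrow> \<Gamma> \<turnstile> WRec c \<simeq> WRec c' \<Colon> Pi (W A B) C"
| eq_WRec_WSup: "W A B # \<Gamma> \<turnstile> C \<Colon> Univ i \<Longrightarrow> wrec_ctx \<Gamma> A B C \<turnstile> c \<Colon> wrec_type C
    \<Longrightarrow> \<Gamma> \<turnstile> t \<Colon> A \<Longrightarrow> \<Gamma> \<turnstile> u \<Colon> Fun (inst B t) (W A B) \<Longrightarrow> F = WRec c
    \<Longrightarrow> \<Gamma> \<turnstile> App F (WSup t u) \<simeq> insts 0 [Lam (App (lift F) (App (lift u) (Var 0))), u, t] c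
          \<Colon> inst C (WSup t u)"

  \<comment> \<open>simple propositions\<close>
| ty_SP: "wf_ctx \<Gamma> \<Longrightarrow> \<Gamma> \<turnstile> SP \<Colon> TYPE'"
| ty_SBot: "wf_ctx \<Gamma> \<Longrightarrow> \<Gamma> \<turnstile> SBot \<Colon> SP"
| ty_SAtom: "\<Gamma> \<turnstile> A \<Colon> SET \<Longrightarrow> \<Gamma> \<turnstile> SAtom A \<Colon> SP"
| ty_SAnd: "\<Gamma> \<turnstile> P \<Colon> SP \<Longrightarrow> \<Gamma> \<turnstile> Q \<Colon> SP \<Longrightarrow> \<Gamma> \<turnstile> SAnd P Q \<Colon> SP"
| ty_SOr: "\<Gamma> \<turnstile> P \<Colon> SP \<Longrightarrow> \<Gamma> \<turnstile> Q \<Colon> SP \<Longrightarrow> \<Gamma> \<turnstile> SOr P Q \<Colon> SP"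
| ty_SImp: "\<Gamma> \<turnstile> P \<Colon> SP \<Longrightarrow> \<Gamma> \<turnstile> Q \<Colon> SP \<Longrightarrow> \<Gamma> \<turnstile> SImp P Q \<Colon> SP"
| ty_SAll: "\<Gamma> \<turnstile> A \<Colon> SET \<Longrightarrow> \<Gamma> \<turnstile> P \<Colon> Fun A SP \<Longrightarrow> \<Gamma> \<turnstile> SAll A P \<Colon> SP"
| ty_SEx: "\<Gamma> \<turnstile> A \<Colon> SET \<Longrightarrow> \<Gamma> \<turnstile> P \<Colon> Fun A SP \<Longrightarrow> \<Gamma> \<turnstile> SEx A P \<Colon> SP"
| ty_SPRec: "SP # \<Gamma> \<turnstile> C \<Colon> Univ i \<Longrightarrow> sp_cases has_type \<Gamma> C b0 b1 b2 b3 b4 b5 b6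
    \<Longrightarrow> \<Gamma> \<turnstile> SPRec b0 b1 b2 b3 b4 b5 b6 \<Colon> Pi SP C"
| eq_SAtom: "\<Gamma> \<turnstile> A \<simeq> A' \<Colon> SET \<Longrightarrow> \<Gamma> \<turnstile> SAtom A \<simeq> SAtom A' \<Colon> SP"
| eq_SAnd: "\<Gamma> \<turnstile> P \<simeq> P' \<Colon> SP \<Longrightarrow> \<Gamma> \<turnstile> Q \<simeq> Q' \<Colon> SP \<Longrightarrow> \<Gamma> \<turnstile> SAnd P Q \<simeq> SAnd P' Q' \<Colon> SP"
| eq_SOr: "\<Gamma> \<turnstile> P \<simeq> P' \<Colon> SP \<Longrightarrow> \<Gamma> \<turnstile> Q \<simeq> Q' \<Colon> SP \<Longrightarrow> \<Gamma> \<turnstile> SOr P Q \<simeq> SOr P' Q' \<Colon> SP"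
| eq_SImp: "\<Gamma> \<turnstile> P \<simeq> P' \<Colon> SP \<Longrightarrow> \<Gamma> \<turnstile> Q \<simeq> Q' \<Colon> SP \<Longrightarrow> \<Gamma> \<turnstile> SImp P Q \<simeq> SImp P' Q' \<Colon> SP"
| eq_SAll: "\<Gamma> \<turnstile> A \<simeq> A' \<Colon> SET \<Longrightarrow> \<Gamma> \<turnstile> P \<simeq> P' \<Colon> Fun A SP \<Longrightarrow> \<Gamma> \<turnstile> SAll A P \<simeq> SAll A' P' \<Colon> SP"
| eq_SEx: "\<Gamma> \<turnstile> A \<simeq> A' \<Colon> SET \<Longrightarrow> \<Gamma> \<turnstile> P \<simeq> P' \<Colon> Fun A SP \<Longrightarrow> \<Gamma> \<turnstile> SEx A P \<simeq> SEx A' P' \<Colon> SP"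
| eq_SPRec: "SP # \<Gamma> \<turnstile> C \<Colon> Univ i
    \<Longrightarrow> \<Gamma> \<turnstile> b0 \<simeq> b0' \<Colon> inst C SBot
    \<Longrightarrow> SET # \<Gamma> \<turnstile> b1 \<simeq> b1' \<Colon> insts 1 [SAtom (Var 0)] C
    \<Longrightarrow> sp_ctx_bin \<Gamma> C \<turnstile> b2 \<simeq> b2' \<Colon> sp_type_bin SAnd C
    \<Longrightarrow> sp_ctx_bin \<Gamma> C \<turnstile> b3 \<simeq> b3' \<Colon> sp_type_bin SOr C
    \<Longrightarrow> sp_ctx_bin \<Gamma> C \<turnstile> b4 \<simeq> b4' \<Colon> sp_type_bin SImp C
    \<Longrightarrow> sp_ctx_quant \<Gamma> C \<turnstile> b5 \<simeq> b5' \<Colon> sp_type_quant SAll C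
    \<Longrightarrow> sp_ctx_quant \<Gamma> C \<turnstile> b6 \<simeq> b6' \<Colon> sp_type_quant SEx C
    \<Longrightarrow> \<Gamma> \<turnstile> SPRec b0 b1 b2 b3 b4 b5 b6 \<simeq> SPRec b0' b1' b2' b3' b4' b5' b6' \<Colon> Pi SP C"
| eq_SPRec_SBot: "SP # \<Gamma> \<turnstile> C \<Colon> Univ i \<Longrightarrow> sp_cases has_type \<Gamma> C b0 b1 b2 b3 b4 b5 b6
    \<Longrightarrow> \<Gamma> \<turnstile> App (SPRec b0 b1 b2 b3 b4 b5 b6) SBot \<simeq> b0 \<Colon> inst C SBot"
| eq_SPRec_SAtom: "SP # \<Gamma> \<turnstile> C \<Colon> Univ i \<Longrightarrow> sp_cases has_type \<Gamma> C b0 b1 b2 b3 b4 b5 b6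
    \<Longrightarrow> \<Gamma> \<turnstile> A \<Colon> SET
    \<Longrightarrow> \<Gamma> \<turnstile> App (SPRec b0 b1 b2 b3 b4 b5 b6) (SAtom A) \<simeq> inst b1 A \<Colon> inst C (SAtom A)"
| eq_SPRec_SAnd: "SP # \<Gamma> \<turnstile> C \<Colon> Univ i \<Longrightarrow> sp_cases has_type \<Gamma> C b0 b1 b2 b3 b4 b5 b6
    \<Longrightarrow> \<Gamma> \<turnstile> P \<Colon> SP \<Longrightarrow> \<Gamma> \<turnstile> Q \<Colon> SP \<Longrightarrow> F = SPRec b0 b1 b2 b3 b4 b5 b6
    \<Longrightarrow> \<Gamma> \<turnstile> App F (SAnd P Q) \<simeq> insts 0 [App F Q, App F P, Q, P] b2 \<Colon> inst C (SAnd P Q)"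
| eq_SPRec_SOr: "SP # \<Gamma> \<turnstile> C \<Colon> Univ i \<Longrightarrow> sp_cases has_type \<Gamma> C b0 b1 b2 b3 b4 b5 b6
    \<Longrightarrow> \<Gamma> \<turnstile> P \<Colon> SP \<Longrightarrow> \<Gamma> \<turnstile> Q \<Colon> SP \<Longrightarrow> F = SPRec b0 b1 b2 b3 b4 b5 b6
    \<Longrightarrow> \<Gamma> \<turnstile> App F (SOr P Q) \<simeq> insts 0 [App F Q, App F P, Q, P] b3 \<Colon> inst C (SOr P Q)"
| eq_SPRec_SImp: "SP # \<Gamma> \<turnstile> C \<Colon> Univ i \<Longrightarrow> sp_cases has_type \<Gamma> C b0 b1 b2 b3 b4 b5 b6
    \<Longrightarrow> \<Gamma> \<turnstile> P \<Colon> SP \<Longrightarrow> \<Gamma> \<turnstile> Q \<Colon> SP \<Longrightarrow> F = SPRec b0 b1 b2 b3 b4 b5 b6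
    \<Longrightarrow> \<Gamma> \<turnstile> App F (SImp P Q) \<simeq> insts 0 [App F Q, App F P, Q, P] b4 \<Colon> inst C (SImp P Q)"
| eq_SPRec_SAll: "SP # \<Gamma> \<turnstile> C \<Colon> Univ i \<Longrightarrow> sp_cases has_type \<Gamma> C b0 b1 b2 b3 b4 b5 b6
    \<Longrightarrow> \<Gamma> \<turnstile> A \<Colon> SET \<Longrightarrow> \<Gamma> \<turnstile> P \<Colon> Fun A SP \<Longrightarrow> F = SPRec b0 b1 b2 b3 b4 b5 b6
    \<Longrightarrow> \<Gamma> \<turnstile> App F (SAll A P) \<simeq> insts 0 [Lam (App (lift F) (App (lift P) (Var 0))), P, A] b5
          \<Colon> inst C (SAll A P)"
| eq_SPRec_SEx: "SP # \<Gamma> \<turnstile> C \<Colon> Univ i \<Longrightarrow> sp_cases has_type \<Gamma> C b0 b1 b2 b3 b4 b5 b6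
    \<Longrightarrow> \<Gamma> \<turnstile> A \<Colon> SET \<Longrightarrow> \<Gamma> \<turnstile> P \<Colon> Fun A SP \<Longrightarrow> F = SPRec b0 b1 b2 b3 b4 b5 b6
    \<Longrightarrow> \<Gamma> \<turnstile> App F (SEx A P) \<simeq> insts 0 [Lam (App (lift F) (App (lift P) (Var 0))), P, A] b6
          \<Colon> inst C (SEx A P)"


section \<open>Types, crude types and modified realisability\<close>

text \<open>\<open>Tp\<close> and \<open>Cr\<close> have type \<open>SP \<rightarrow> Set\<close>.\<close>

definition Tp :: tm where
  "Tp = SPRec
     Empty
     (Var 0)
     (Prod (Var 1) (Var 0))
     (Plus (Var 1) (Var 0))
     (Fun (Var 1) (Var 0))
     (Pi (Var 2) (App (Var 1) (Var 0)))
     (Sig (Var 2) (App (Var 1) (Var 0)))"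

definition Cr :: tm where
  "Cr = SPRec
     Unit
     Unit
     (Prod (Var 1) (Var 0))
     (Plus (Var 1) (Var 0))
     (Fun (Var 1) (Var 0))
     (Pi (Var 2) (App (Var 1) (Var 0)))
     (Sig (Var 2) (App (Var 1) (Var 0)))"

text \<open>
  \<open>MR\<close> has type \<open>(\<Pi> S : SP) (Cr S \<rightarrow> Set)\<close>.  In named notation its cases are
  \<^item> \<open>\<lambda>r. \<emptyset>\<close> and \<open>\<lambda>r. A\<close>,
  \<^item> \<open>\<lambda>r. p (r.1) \<times> q (r.2)\<close>,
  \<^item> the function on \<open>Cr P + Cr Q\<close> with \<open>inl s \<mapsto> p s\<close> and \<open>inr t \<mapsto> q t\<close>,
  \<^item> \<open>\<lambda>r. (Tp P \<rightarrow> Tp Q) \<times> (\<Pi> s : Cr P) (p s \<rightarrow> q (r s))\<close>,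
  \<^item> \<open>\<lambda>r. (\<Pi> x : A) p x (r x)\<close>,
  \<^item> \<open>\<lambda>r. p (r.1) (r.2)\<close>,

  where \<open>p\<close>, \<open>q\<close> are \<open>MR P\<close>, \<open>MR Q\<close> and, for the quantifiers, \<open>p x\<close> is \<open>MR (P x)\<close>.
\<close>

definition MR :: tm where
  "MR = SPRec
     (Lam Empty)
     (Lam (Var 1))
     (Lam (Prod (App (Var 2) (Fst (Var 0))) (App (Var 1) (Snd (Var 0)))))
     (PlusRec (App (Var 2) (Var 0)) (App (Var 1) (Var 0)))
     (Lam (Prod
        (Fun (App Tp (Var 4)) (App Tp (Var 3)))
        (Pi (App Cr (Var 4))
          (Fun (App (Var 3) (Var 0)) (App (Var 2) (App (Var 1) (Var 0)))))))
     (Lam (Pi (Var 3) (App (App (Var 2) (Var 0)) (App (Var 1) (Var 0)))))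
     (Lam (App (App (Var 1) (Fst (Var 0))) (Snd (Var 0))))"

end

(*
  The term is the expected one: it is defined by recursion on S, and turns a realiser r of S and
  an evidence m of MR(S, r) into an element of Tp(S).  It computes componentwise on conjunctions
  and quantifiers and by cases on r for disjunctions; for an implication, m contains an element of
  Tp(A) -> Tp(B) by the truth clause of MR, so the recursive calls are not needed.  The work is in
  the typing derivation.  The general weakening and substitution theorems are avoided: the closed
  terms Tp, Cr, MR are typed in every context, and parameters are assumed to keep their type under
  context extension.
*)

theory Submission
  imports Defs
begin

section \<open>Calculus of instantiations\<close>

text \<open>Avoiding substitution into derivations shapes the statements. Computing
  \<open>MR\<close> at \<open>SAnd P Q\<close> yields a \<open>Lam\<close> whose body mentions
  \<open>App MR P\<close> and \<open>App MR Q\<close>, and \<open>eq_beta\<close> asks for a typing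
  of that body. So the bodies of the compound clauses are typed for arbitrary stable predicates
  \<open>p\<close>, \<open>q\<close>: with variables this gives the premises of
  \<open>SPRec\<close>, with the values of \<open>MR\<close> it gives those of
  \<open>eq_beta\<close>. A second obstacle is that types match only up to syntactic identity, while
  lifts and instantiations pile up. All of them are brought to the form \<open>insts k us\<close>,
  which is closed under composition and passage under binders, so that simplification can check
  these identities. What agrees only by computation, such as \<open>App Cr (SAnd P Q)\<close> and
  the corresponding \<open>Prod\<close>, goes through \<open>ty_conv\<close>.\<close>

lemma up_Var_ren: "up (\<lambda>n. Var (\<rho> n)) = (\<lambda>n. Var (up_ren \<rho> n))"
  by (auto simp: up_def up_ren_def fun_eq_iff split: nat.split)

lemma ups_Var_ren: "(up ^^ k) (\<lambda>n. Var (\<rho> n)) = (\<lambda>n. Var ((up_ren ^^ k) \<rho> n))"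
  by (induction k) (simp_all add: up_Var_ren)

lemma ren_eq_subst: "ren \<rho> t = subst (\<lambda>n. Var (\<rho> n)) t"
  by (induction t arbitrary: \<rho>) (simp_all add: up_Var_ren ups_Var_ren)

lemma up_up_ren: "(\<lambda>n. up \<sigma> (up_ren \<rho> n)) = up (\<lambda>n. \<sigma> (\<rho> n))"
  by (auto simp: up_def up_ren_def fun_eq_iff split: nat.split)

lemma ups_up_rens: "(\<lambda>n. (up ^^ k) \<sigma> ((up_ren ^^ k) \<rho> n)) = (up ^^ k) (\<lambda>n. \<sigma> (\<rho> n))"
  by (induction k) (simp_all add: up_up_ren)

lemma subst_ren: "subst \<sigma> (ren \<rho> t) = subst (\<lambda>n. \<sigma> (\<rho> n)) t"
  by (induction t arbitrary: \<sigma> \<rho>) (simp_all add: up_up_ren ups_up_rens)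

lemma ren_ren: "ren \<rho> (ren \<rho>' t) = ren (\<lambda>n. \<rho> (\<rho>' n)) t"
  by (simp add: ren_eq_subst[of \<rho>] ren_eq_subst[of "\<lambda>n. \<rho> (\<rho>' n)"] subst_ren)

lemma ren_up: "(\<lambda>n. ren (up_ren \<rho>) (up \<sigma> n)) = up (\<lambda>n. ren \<rho> (\<sigma> n))"
  by (auto simp: up_def up_ren_def fun_eq_iff ren_ren split: nat.split)

lemma ren_ups: "(\<lambda>n. ren ((up_ren ^^ k) \<rho>) ((up ^^ k) \<sigma> n)) = (up ^^ k) (\<lambda>n. ren \<rho> (\<sigma> n))"
  by (induction k) (simp_all add: ren_up)

lemma ren_subst: "ren \<rho> (subst \<sigma> t) = subst (\<lambda>n. ren \<rho> (\<sigma> n)) t"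
  by (induction t arbitrary: \<sigma> \<rho>) (simp_all add: ren_up ren_ups)

lemma subst_up: "(\<lambda>n. subst (up \<tau>) (up \<sigma> n)) = up (\<lambda>n. subst \<tau> (\<sigma> n))"
  by (auto simp: up_def fun_eq_iff ren_subst subst_ren split: nat.split)

lemma subst_ups: "(\<lambda>n. subst ((up ^^ k) \<tau>) ((up ^^ k) \<sigma> n)) = (up ^^ k) (\<lambda>n. subst \<tau> (\<sigma> n))"
  by (induction k) (simp_all add: subst_up)

text \<open>Under a binder \<open>up\<close> lifts the substituted terms, so composing two
  substitutions presupposes the two mixed laws \<open>ren_subst\<close> and
  \<open>subst_ren\<close>; hence the ladder of lemmas above.\<close>

lemma subst_subst: "subst \<tau> (subst \<sigma> t) = subst (\<lambda>n. subst \<tau> (\<sigma> n)) t"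
  by (induction t arbitrary: \<sigma> \<tau>) (simp_all add: subst_up subst_ups)

lemma up_Var: "up Var = Var"
  by (auto simp: up_def fun_eq_iff split: nat.split)

lemma ups_Var: "(up ^^ k) Var = Var"
  by (induction k) (simp_all add: up_Var)

lemma subst_Var: "subst Var t = t"
  by (induction t) (simp_all add: up_Var ups_Var)

lemma insts_Nil: "insts 0 [] t = t"
  by (simp add: insts_def subst_Var)

text \<open>One variable is consumed and one is added in its place: 0 goes to 0, and a positive
  \<open>n\<close> goes to \<open>n - 1 + 1\<close>.\<close>

lemma insts_Var_0: "insts (Suc 0) [Var 0] t = t"
proof -
  have "(\<lambda>n. if n < length [Var 0] then [Var 0] ! n else Var (n - length [Var 0] + Suc 0)) = Var"
    by (auto simp: fun_eq_iff)
  then show ?thesis by (simp only: insts_def subst_Var)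
qed

text \<open>The \<open>l\<close> variables introduced by the inner instantiation meet the first
  entries of \<open>us\<close>. If \<open>us\<close> is longer, its tail \<open>drop l us\<close>
  acts on the older variables of \<open>t\<close>; if it is shorter, \<open>l - length us\<close> of
  the new variables survive. Truncated subtraction covers both cases at once.\<close>

lemma insts_insts:
  "insts k us (insts l vs t) = insts (k + (l - length us)) (map (insts k us) vs @ drop l us) t"
  unfolding insts_def subst_subst
  by (rule arg_cong[where f = "\<lambda>\<sigma>. subst \<sigma> t"]) (auto simp: fun_eq_iff nth_append add.commute)

lemma lift_eq_insts: "lift t = insts (Suc 0) [] t"
  by (simp add: ren_eq_subst insts_def)

lemma ren_add_eq_insts: "ren (\<lambda>m. m + k) t = insts k [] t"
  by (simp add: ren_eq_subst insts_def)

lemma up_insts: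
  "up (\<lambda>n. if n < length us then us ! n else Var (n - length us + k)) =
    (\<lambda>n. if n < length (Var 0 # map lift us) then (Var 0 # map lift us) ! n
      else Var (n - length (Var 0 # map lift us) + Suc k))"
  by (auto simp: up_def fun_eq_iff split: nat.split)

lemma insts_Var:
  "insts k [] (Var n) = Var (n + k)"
  "insts k (u # us) (Var 0) = u"
  "insts k (u # us) (Var (Suc n)) = insts k us (Var n)"
  by (simp_all add: insts_def)

lemma insts_tm:
  "insts k us (Univ i) = Univ i"
  "insts k us (Pi A B) = Pi (insts k us A) (insts (Suc k) (Var 0 # map lift us) B)"
  "insts k us (Lam t) = Lam (insts (Suc k) (Var 0 # map lift us) t)"
  "insts k us (App t u) = App (insts k us t) (insts k us u)"
  "insts k us (Sig A B) = Sig (insts k us A) (insts (Suc k) (Var 0 # map lift us) B)"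
  "insts k us (Pair t u) = Pair (insts k us t) (insts k us u)"
  "insts k us (Fst t) = Fst (insts k us t)"
  "insts k us (Snd t) = Snd (insts k us t)"
  "insts k us Empty = Empty"
  "insts k us Unit = Unit"
  "insts k us (Plus A B) = Plus (insts k us A) (insts k us B)"
  "insts k us (InL t) = InL (insts k us t)"
  "insts k us (InR t) = InR (insts k us t)"
  "insts k us (PlusRec c d) =
     PlusRec (insts (Suc k) (Var 0 # map lift us) c) (insts (Suc k) (Var 0 # map lift us) d)"
  "insts k us SP = SP"
  "insts k us SBot = SBot"
  "insts k us (SAtom A) = SAtom (insts k us A)"
  "insts k us (SAnd P Q) = SAnd (insts k us P) (insts k us Q)"
  "insts k us (SOr P Q) = SOr (insts k us P) (insts k us Q)"
  "insts k us (SImp P Q) = SImp (insts k us P) (insts k us Q)"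
  "insts k us (SAll A P) = SAll (insts k us A) (insts k us P)"
  "insts k us (SEx A P) = SEx (insts k us A) (insts k us P)"
  unfolding insts_def up_insts[symmetric] by simp_all

lemma subst_Tp: "subst \<sigma> Tp = Tp" and subst_Cr: "subst \<sigma> Cr = Cr"
  by (simp_all add: Tp_def Cr_def up_def up_ren_def eval_nat_numeral)

lemma subst_MR: "subst \<sigma> MR = MR"
  by (simp add: MR_def ren_eq_subst[of _ Tp] ren_eq_subst[of _ Cr] subst_Tp subst_Cr
      up_def up_ren_def eval_nat_numeral)

lemma insts_closed:
  "insts k us Tp = Tp" "insts k us Cr = Cr" "insts k us MR = MR"
  by (simp_all add: insts_def subst_Tp subst_Cr subst_MR)

text \<open>The rewrite system that checks syntactic identities: everything becomes
  \<open>insts\<close>, composites are merged, and numerals become successors so that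
  \<open>insts_Var\<close> can walk along the list.\<close>

lemmas calc = lift_eq_insts ren_add_eq_insts insts_insts insts_Nil insts_Var_0 insts_Var insts_tm
  insts_closed numeral_eq_Suc


section \<open>Derived rules\<close>

lemma wf_ctx_drop_Cons:
  "(\<forall>k. wf_ctx (drop k (A # \<Gamma>))) \<longleftrightarrow> wf_ctx (A # \<Gamma>) \<and> (\<forall>k. wf_ctx (drop k \<Gamma>))"
  by (metis drop0 drop_Suc_Cons not0_implies_Suc)

text \<open>
  Some premises live only in an extended context \<open>A # \<Gamma>\<close>, so the induction has to carry
  all tails of the context.
\<close>

lemma wf_ctx_drop: "wf_ctx \<Gamma> \<Longrightarrow> \<forall>k. wf_ctx (drop k \<Gamma>)"
  and has_type_wf_drop: "\<Gamma> \<turnstile> t \<Colon> A \<Longrightarrow> \<forall>k. wf_ctx (drop k \<Gamma>)"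
  and eq_type_wf_drop: "\<Gamma> \<turnstile> t \<simeq> u \<Colon> A \<Longrightarrow> \<forall>k. wf_ctx (drop k \<Gamma>)"
  by (induction rule: wf_ctx_has_type_eq_type.inducts)
    (simp_all only: wf_ctx_drop_Cons, auto intro: wf_nil wf_cons)

lemma has_type_wf: "\<Gamma> \<turnstile> t \<Colon> A \<Longrightarrow> wf_ctx \<Gamma>"
  using has_type_wf_drop[of \<Gamma> t A] by (metis drop0)

lemma wf_SET: "wf_ctx \<Gamma> \<Longrightarrow> wf_ctx (SET # \<Gamma>)"
  by (rule wf_cons[OF ty_univ])

lemma wf_SP: "wf_ctx \<Gamma> \<Longrightarrow> wf_ctx (SP # \<Gamma>)"
  by (rule wf_cons[OF ty_SP])

lemma ty_TYPE: "\<Gamma> \<turnstile> A \<Colon> SET \<Longrightarrow> \<Gamma> \<turnstile> A \<Colon> TYPE'"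
  using ty_cumul by fastforce

lemma eq_TYPE: "\<Gamma> \<turnstile> A \<simeq> B \<Colon> SET \<Longrightarrow> \<Gamma> \<turnstile> A \<simeq> B \<Colon> TYPE'"
  using eq_cumul by fastforce

lemma ty_SET: "wf_ctx \<Gamma> \<Longrightarrow> \<Gamma> \<turnstile> SET \<Colon> TYPE'"
  using ty_univ by fastforce

text \<open>In the primed rules the resulting type enters through an equation. The pattern
  \<open>inst B u\<close> rarely matches a goal by unification, but the equation can be left to
  \<open>calc\<close>.\<close>

lemma ty_var': "wf_ctx \<Gamma> \<Longrightarrow> n < length \<Gamma> \<Longrightarrow> A = insts (Suc n) [] (\<Gamma> ! n) \<Longrightarrow> \<Gamma> \<turnstile> Var n \<Colon> A"
  using ty_var[of \<Gamma> n] by (simp only: ren_add_eq_insts)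

lemma ty_App': "\<Gamma> \<turnstile> t \<Colon> Pi A B \<Longrightarrow> \<Gamma> \<turnstile> u \<Colon> A \<Longrightarrow> C = inst B u \<Longrightarrow> \<Gamma> \<turnstile> App t u \<Colon> C"
  using ty_App by simp

lemma eq_App': "\<Gamma> \<turnstile> t \<simeq> t' \<Colon> Pi A B \<Longrightarrow> \<Gamma> \<turnstile> u \<Colon> A \<Longrightarrow> C = inst B u \<Longrightarrow> \<Gamma> \<turnstile> App t u \<simeq> App t' u \<Colon> C"
  using eq_App eq_refl by blast

lemma eq_beta': "\<Gamma> \<turnstile> A \<Colon> Univ i \<Longrightarrow> A # \<Gamma> \<turnstile> t \<Colon> B \<Longrightarrow> \<Gamma> \<turnstile> u \<Colon> A
    \<Longrightarrow> v = inst t u \<Longrightarrow> C = inst B u \<Longrightarrow> \<Gamma> \<turnstile> App (Lam t) u \<simeq> v \<Colon> C"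
  using eq_beta by simp

lemma ty_Snd': "\<Gamma> \<turnstile> t \<Colon> Sig A B \<Longrightarrow> C = inst B (Fst t) \<Longrightarrow> \<Gamma> \<turnstile> Snd t \<Colon> C"
  using ty_Snd by simp

text \<open>
  Typing that survives every extension of the context; it holds for variables and closed terms,
  and using it as a hypothesis avoids the weakening theorem.
\<close>

definition stable :: "ctx \<Rightarrow> tm \<Rightarrow> tm \<Rightarrow> bool" where
  "stable \<Gamma> t A \<longleftrightarrow> (\<forall>\<Delta>. wf_ctx (\<Delta> @ \<Gamma>) \<longrightarrow>
     \<Delta> @ \<Gamma> \<turnstile> insts (length \<Delta>) [] t \<Colon> insts (length \<Delta>) [] A)"

lemma stable_ty: "stable \<Gamma> t A \<Longrightarrow> wf_ctx \<Gamma> \<Longrightarrow> \<Gamma> \<turnstile> t \<Colon> A"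
  unfolding stable_def using insts_Nil by (metis append_Nil list.size(3))

lemma stable_append:
  "stable \<Gamma> t A \<Longrightarrow> stable (\<Delta> @ \<Gamma>) (insts (length \<Delta>) [] t) (insts (length \<Delta>) [] A)"
  unfolding stable_def
proof (intro allI impI)
  fix \<Delta>'
  assume *: "\<forall>\<Delta>. wf_ctx (\<Delta> @ \<Gamma>) \<longrightarrow> \<Delta> @ \<Gamma> \<turnstile> insts (length \<Delta>) [] t \<Colon> insts (length \<Delta>) [] A"
    and "wf_ctx (\<Delta>' @ \<Delta> @ \<Gamma>)"
  then show "\<Delta>' @ \<Delta> @ \<Gamma> \<turnstile> insts (length \<Delta>') [] (insts (length \<Delta>) [] t)
      \<Colon> insts (length \<Delta>') [] (insts (length \<Delta>) [] A)"
    using *[rule_format, of "\<Delta>' @ \<Delta>"] by (simp add: calc)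
qed

lemma stable_Cons: "stable \<Gamma> t A \<Longrightarrow> stable (B # \<Gamma>) (insts (Suc 0) [] t) (insts (Suc 0) [] A)"
  using stable_append[of \<Gamma> t A "[B]"] by simp

lemma stable_Var: "n < length \<Gamma> \<Longrightarrow> A = insts (Suc n) [] (\<Gamma> ! n) \<Longrightarrow> stable \<Gamma> (Var n) A"
  unfolding stable_def by (auto simp: calc nth_append add.commute intro!: ty_var')

text \<open>The recursion equations of \<open>ren\<close> would push \<open>lift\<close> into terms
  and compete with its translation into \<open>insts\<close>.\<close>

declare ren.simps [simp del] calc [simp]

lemma stable_App: "stable \<Gamma> t (Pi A B) \<Longrightarrow> stable \<Gamma> u A \<Longrightarrow> C = inst B u \<Longrightarrow> stable \<Gamma> (App t u) C"
  unfolding stable_def by (auto intro!: ty_App')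

lemma stable_SP:
  "stable \<Gamma> P SP \<Longrightarrow> stable \<Gamma> Q SP \<Longrightarrow> stable \<Gamma> (SAnd P Q) SP"
  "stable \<Gamma> P SP \<Longrightarrow> stable \<Gamma> Q SP \<Longrightarrow> stable \<Gamma> (SOr P Q) SP"
  "stable \<Gamma> P SP \<Longrightarrow> stable \<Gamma> Q SP \<Longrightarrow> stable \<Gamma> (SImp P Q) SP"
  "stable \<Gamma> A SET \<Longrightarrow> stable \<Gamma> P' (Pi A SP) \<Longrightarrow> stable \<Gamma> (SAll A P') SP"
  "stable \<Gamma> A SET \<Longrightarrow> stable \<Gamma> P' (Pi A SP) \<Longrightarrow> stable \<Gamma> (SEx A P') SP"
  unfolding stable_def by (auto intro!: ty_SAnd ty_SOr ty_SImp ty_SAll ty_SEx)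

text \<open>\<open>Tp\<close> and \<open>Cr\<close> share all clauses except those for
  \<open>SBot\<close> and \<open>SAtom\<close>, so their typing and computation rules are derived
  once, with these two clauses as parameters.\<close>

locale type_family =
  fixes F b0 b1
  assumes F_eq: "F = SPRec b0 b1 (Prod (Var 1) (Var 0)) (Plus (Var 1) (Var 0)) (Fun (Var 1) (Var 0))
     (Pi (Var 2) (App (Var 1) (Var 0))) (Sig (Var 2) (App (Var 1) (Var 0)))"
    and ty_b0: "wf_ctx \<Gamma> \<Longrightarrow> \<Gamma> \<turnstile> b0 \<Colon> SET"
    and ty_b1: "wf_ctx \<Gamma> \<Longrightarrow> SET # \<Gamma> \<turnstile> b1 \<Colon> SET"
    and insts_F: "insts k us F = F"
begin

lemma F_cases:
  assumes "wf_ctx \<Gamma>"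
  shows "sp_cases has_type \<Gamma> SET b0 b1 (Prod (Var 1) (Var 0)) (Plus (Var 1) (Var 0)) (Fun (Var 1) (Var 0))
     (Pi (Var 2) (App (Var 1) (Var 0))) (Sig (Var 2) (App (Var 1) (Var 0)))"
proof -
  note wf = wf_SET[OF wf_SET[OF wf_SP[OF wf_SP[OF assms]]]]
  have p: "SET # SET # SP # SP # \<Gamma> \<turnstile> Var 1 \<Colon> SET" and q: "SET # SET # SP # SP # \<Gamma> \<turnstile> Var 0 \<Colon> SET"
    by (rule ty_var'; simp add: calc wf)+
  \<comment> \<open>The second component of \<open>Prod\<close> and \<open>Fun\<close> lies under
    one more binder, where the recursive value \<open>Var 0\<close> has become
    \<open>Var 1\<close>.\<close>
  have q': "Var 1 # SET # SET # SP # SP # \<Gamma> \<turnstile> Var 1 \<Colon> SET"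
    by (rule ty_var') (simp_all add: calc wf_cons[OF p[simplified]])
  have 1: "SET # \<Gamma> \<turnstile> Var 0 \<Colon> SET"
    by (rule ty_var') (simp_all add: calc wf_SET assms)
  have 2: "SET # \<Gamma> \<turnstile> Pi (Var 0) SP \<Colon> TYPE'"
    by (rule ty_Pi[OF ty_TYPE[OF 1] ty_SP[OF wf_cons[OF 1]]])
  have 3: "Pi (Var 0) SP # SET # \<Gamma> \<turnstile> Var 1 \<Colon> SET"
    by (rule ty_var') (simp_all add: calc wf_cons[OF 2])
  have "Pi (Var 0) SP # SET # \<Gamma> \<turnstile> Pi (Var 1) SET \<Colon> TYPE'"
    by (rule ty_Pi[OF ty_TYPE[OF 3] ty_SET[OF wf_cons[OF 3]]])
  note wf' = wf_cons[OF this]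
  have A: "Pi (Var 1) SET # Pi (Var 0) SP # SET # \<Gamma> \<turnstile> Var 2 \<Colon> SET"
    using wf' by (intro ty_var') (simp_all add: calc)
  note wf'' = wf_cons[OF A]
  have P: "Var 2 # Pi (Var 1) SET # Pi (Var 0) SP # SET # \<Gamma> \<turnstile> App (Var 1) (Var 0) \<Colon> SET"
    using wf'' by (intro ty_App'[where A = "Var 3" and B = SET] ty_var') (simp_all add: calc)
  show ?thesis
    using ty_b0[OF assms] ty_b1[OF assms] ty_Sig[OF p q'] ty_Plus[OF p q] ty_Pi[OF p q'] ty_Pi[OF A P] ty_Sig[OF A P]
    by (simp add: calc)
qed

lemma ty_F: "wf_ctx \<Gamma> \<Longrightarrow> \<Gamma> \<turnstile> F \<Colon> Pi SP SET"
  unfolding F_eq by (rule ty_SPRec[OF ty_SET F_cases]) (auto intro: wf_SP)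

lemma ty_App_F: "\<Gamma> \<turnstile> P \<Colon> SP \<Longrightarrow> \<Gamma> \<turnstile> App F P \<Colon> SET"
  by (rule ty_App'[OF ty_F]) (auto simp: calc intro: has_type_wf)

lemma F_SBot: "wf_ctx \<Gamma> \<Longrightarrow> \<Gamma> \<turnstile> App F SBot \<simeq> b0 \<Colon> SET"
  using eq_SPRec_SBot[OF ty_SET[OF wf_SP] F_cases] by (simp add: F_eq calc)

lemma F_SAtom: "\<Gamma> \<turnstile> A \<Colon> SET \<Longrightarrow> \<Gamma> \<turnstile> App F (SAtom A) \<simeq> inst b1 A \<Colon> SET"
  using eq_SPRec_SAtom[OF ty_SET[OF wf_SP] F_cases] has_type_wf by (simp add: F_eq calc)

lemma
  assumes "\<Gamma> \<turnstile> P \<Colon> SP" "\<Gamma> \<turnstile> Q \<Colon> SP"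
  shows F_SAnd: "\<Gamma> \<turnstile> App F (SAnd P Q) \<simeq> Prod (App F P) (App F Q) \<Colon> SET"
    and F_SOr: "\<Gamma> \<turnstile> App F (SOr P Q) \<simeq> Plus (App F P) (App F Q) \<Colon> SET"
    and F_SImp: "\<Gamma> \<turnstile> App F (SImp P Q) \<simeq> Fun (App F P) (App F Q) \<Colon> SET"
proof -
  note wf = has_type_wf[OF assms(1)]
  show "\<Gamma> \<turnstile> App F (SAnd P Q) \<simeq> Prod (App F P) (App F Q) \<Colon> SET"
    using eq_SPRec_SAnd[OF ty_SET[OF wf_SP[OF wf]] F_cases[OF wf] assms F_eq] by (simp add: calc)
  show "\<Gamma> \<turnstile> App F (SOr P Q) \<simeq> Plus (App F P) (App F Q) \<Colon> SET"
    using eq_SPRec_SOr[OF ty_SET[OF wf_SP[OF wf]] F_cases[OF wf] assms F_eq] by (simp add: calc)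
  show "\<Gamma> \<turnstile> App F (SImp P Q) \<simeq> Fun (App F P) (App F Q) \<Colon> SET"
    using eq_SPRec_SImp[OF ty_SET[OF wf_SP[OF wf]] F_cases[OF wf] assms F_eq] by (simp add: calc)
qed

lemma
  assumes PQ: "\<Gamma> \<turnstile> P \<Colon> SP" "\<Gamma> \<turnstile> Q \<Colon> SP"
  shows InL: "\<And>s. \<Gamma> \<turnstile> s \<Colon> App F P \<Longrightarrow> \<Gamma> \<turnstile> InL s \<Colon> App F (SOr P Q)"
    and InR: "\<And>s. \<Gamma> \<turnstile> s \<Colon> App F Q \<Longrightarrow> \<Gamma> \<turnstile> InR s \<Colon> App F (SOr P Q)"
  using ty_conv[OF ty_InL[OF PQ[THEN ty_App_F]] eq_sym[OF F_SOr[OF PQ]]]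
    ty_conv[OF ty_InR[OF PQ[THEN ty_App_F]] eq_sym[OF F_SOr[OF PQ]]] by blast+

lemma ty_family:
  assumes "\<Gamma> \<turnstile> A \<Colon> SET" "stable \<Gamma> P (Pi A SP)"
  shows "A # \<Gamma> \<turnstile> App F (App (lift P) (Var 0)) \<Colon> SET"
proof -
  note wf = wf_cons[OF assms(1)]
  have "A # \<Gamma> \<turnstile> Var 0 \<Colon> lift A"
    by (rule ty_var'[OF wf]) simp_all
  with stable_ty[OF stable_Cons[OF assms(2)] wf] have "A # \<Gamma> \<turnstile> App (lift P) (Var 0) \<Colon> SP"
    by (intro ty_App'[where A = "lift A" and B = SP]) simp_all
  then show ?thesis by (rule ty_App_F)
qed

lemma
  assumes wf: "wf_ctx \<Gamma>" and A: "stable \<Gamma> A SET" and P: "stable \<Gamma> P (Pi A SP)"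
  shows F_SAll: "\<Gamma> \<turnstile> App F (SAll A P) \<simeq> Pi A (App F (App (lift P) (Var 0))) \<Colon> SET"
    and F_SEx: "\<Gamma> \<turnstile> App F (SEx A P) \<simeq> Sig A (App F (App (lift P) (Var 0))) \<Colon> SET"
proof -
  note tA = stable_ty[OF A wf] and wf' = wf_cons[OF stable_ty[OF A wf]]
  have A': "A # \<Gamma> \<turnstile> lift A \<Colon> SET"
    using stable_ty[OF stable_Cons[OF A] wf'] by simp
  have P': "stable (A # \<Gamma>) (lift P) (Pi (lift A) SP)"
    using stable_Cons[OF P] by simp
  have x: "A # \<Gamma> \<turnstile> Var 0 \<Colon> lift A"
    by (rule ty_var'[OF wf']) simp_all
  \<comment> \<open>The recursor passes the family of recursive values as a \<open>Lam\<close>, so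
    its computation rule leaves a redex under the binder; it is contracted here and carried out by
    congruence of \<open>Pi\<close> and \<open>Sig\<close>.\<close>
  have "A # \<Gamma> \<turnstile> App (Lam (App F (App (lift (lift P)) (Var 0)))) (Var 0)
      \<simeq> App F (App (lift P) (Var 0)) \<Colon> SET"
    by (rule eq_beta'[OF A' ty_family[OF A' P'] x]) (simp_all add: insts_F)
  note beta = this[simplified]
  have P_Fun: "\<Gamma> \<turnstile> P \<Colon> Fun A SP"
    using stable_ty[OF P wf] by simp
  show "\<Gamma> \<turnstile> App F (SAll A P) \<simeq> Pi A (App F (App (lift P) (Var 0))) \<Colon> SET"
    using eq_Pi[OF tA eq_refl[OF tA] beta] eq_SPRec_SAll[OF ty_SET[OF wf_SP[OF wf]] F_cases[OF wf] tA P_Fun F_eq]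
    by (auto simp: insts_F intro: eq_trans)
  show "\<Gamma> \<turnstile> App F (SEx A P) \<simeq> Sig A (App F (App (lift P) (Var 0))) \<Colon> SET"
    using eq_Sig[OF tA eq_refl[OF tA] beta] eq_SPRec_SEx[OF ty_SET[OF wf_SP[OF wf]] F_cases[OF wf] tA P_Fun F_eq]
    by (auto simp: insts_F intro: eq_trans)
qed

end

interpretation Tp: type_family Tp Empty "Var 0"
  by unfold_locales (auto simp: Tp_def[symmetric] calc intro: ty_Empty ty_var' wf_SET, simp add: Tp_def)

interpretation Cr: type_family Cr Unit Unit
  by unfold_locales (auto simp: Cr_def[symmetric] calc intro: ty_Unit wf_SET, simp add: Cr_def)


section \<open>Modified realisability\<close>

text \<open>Weakening for stable parameters. Four variables are the deepest case: \<open>r\<close>,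
  the truth component, \<open>s\<close> and the evidence for \<open>s\<close> in the clause for
  implication.\<close>

lemmas weaken1 = stable_ty[OF stable_Cons]
lemmas weaken2 = stable_ty[OF stable_Cons[OF stable_Cons]]
lemmas weaken3 = stable_ty[OF stable_Cons[OF stable_Cons[OF stable_Cons]]]
lemmas weaken4 = stable_ty[OF stable_Cons[OF stable_Cons[OF stable_Cons[OF stable_Cons]]]]

section \<open>Well-typedness of the clauses of \<open>MR\<close>\<close>

lemma ty_pred_App: "\<Gamma> \<turnstile> p \<Colon> Pi A SET \<Longrightarrow> \<Gamma> \<turnstile> r \<Colon> A \<Longrightarrow> \<Gamma> \<turnstile> App p r \<Colon> SET"
  by (rule ty_App'[where B = SET]) simp_all

lemma Cr_SAnd_proj:
  assumes "\<Gamma> \<turnstile> P \<Colon> SP" "\<Gamma> \<turnstile> Q \<Colon> SP" "\<Gamma> \<turnstile> r \<Colon> App Cr (SAnd P Q)"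
  shows "\<Gamma> \<turnstile> Fst r \<Colon> App Cr P" and "\<Gamma> \<turnstile> Snd r \<Colon> App Cr Q"
proof -
  note r = ty_conv[OF assms(3) Cr.F_SAnd[OF assms(1,2)]]
  show "\<Gamma> \<turnstile> Fst r \<Colon> App Cr P" by (rule ty_Fst[OF r])
  show "\<Gamma> \<turnstile> Snd r \<Colon> App Cr Q" by (rule ty_Snd'[OF r]) simp
qed

lemma ty_pred_body_SAnd:
  assumes wf: "wf_ctx \<Gamma>" and st: "stable \<Gamma> P SP" "stable \<Gamma> Q SP"
    "stable \<Gamma> p (Pi (App Cr P) SET)" "stable \<Gamma> q (Pi (App Cr Q) SET)"
  shows "App Cr (SAnd P Q) # \<Gamma> \<turnstile>
    Prod (App (lift p) (Fst (Var 0))) (App (lift q) (Snd (Var 0))) \<Colon> SET"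
proof -
  note w1 = wf_cons[OF Cr.ty_App_F[OF stable_ty[OF stable_SP(1)[OF st(1,2)] wf]]]
  note s1 = st[THEN weaken1, OF w1, simplified]
  have "App Cr (SAnd P Q) # \<Gamma> \<turnstile> Var 0 \<Colon> App Cr (SAnd (lift P) (lift Q))"
    by (rule ty_var'[OF w1]) simp_all
  from ty_pred_App[OF s1(3) Cr_SAnd_proj(1)[OF s1(1,2) this[simplified]]]
  have L: "App Cr (SAnd P Q) # \<Gamma> \<turnstile> App (lift p) (Fst (Var 0)) \<Colon> SET" by simp
  note w2 = wf_cons[OF L]
  note s2 = st[THEN weaken2, OF w2, simplified]
  have "App (lift p) (Fst (Var 0)) # App Cr (SAnd P Q) # \<Gamma> \<turnstile> Var 1
      \<Colon> App Cr (SAnd (lift (lift P)) (lift (lift Q)))"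
    using w2 by (intro ty_var') simp_all
  then have "App (lift p) (Fst (Var 0)) # App Cr (SAnd P Q) # \<Gamma>
    \<turnstile> lift (App (lift q) (Snd (Var 0))) \<Colon> SET"
    using ty_pred_App[OF s2(4) Cr_SAnd_proj(2)[OF s2(1,2)]] by simp
  with L show ?thesis by (rule ty_Sig)
qed

lemma ty_pred_Var:
  assumes wf: "wf_ctx \<Gamma>" and st: "stable \<Gamma> P SP" "stable \<Gamma> p (Pi (App Cr P) SET)"
  shows "App Cr P # \<Gamma> \<turnstile> App (lift p) (Var 0) \<Colon> SET"
proof -
  note w = wf_cons[OF Cr.ty_App_F[OF stable_ty[OF st(1) wf]]]
  show ?thesis
    by (rule ty_pred_App[where A = "App Cr (lift P)"])
      (use weaken1[OF st(2) w] w in \<open>auto intro!: ty_var'\<close>)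
qed

text \<open>This clause is no \<open>Lam\<close>: \<open>PlusRec\<close> yields a function on
  \<open>Plus (App Cr P) (App Cr Q)\<close>, whose domain is then converted along the computation
  rule of \<open>Cr\<close>.\<close>

lemma ty_SOr_pred:
  assumes wf: "wf_ctx \<Gamma>" and st: "stable \<Gamma> P SP" "stable \<Gamma> Q SP"
    "stable \<Gamma> p (Pi (App Cr P) SET)" "stable \<Gamma> q (Pi (App Cr Q) SET)"
  shows "\<Gamma> \<turnstile> PlusRec (App (lift p) (Var 0)) (App (lift q) (Var 0)) \<Colon> Pi (App Cr (SOr P Q)) SET"
proof -
  note P = stable_ty[OF st(1) wf] and Q = stable_ty[OF st(2) wf]
  note Cr_P = Cr.ty_App_F[OF P] and Cr_Q = Cr.ty_App_F[OF Q]
  note Plus = ty_TYPE[OF ty_Plus[OF Cr_P Cr_Q]]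
  have C: "Plus (App Cr P) (App Cr Q) # \<Gamma> \<turnstile> SET \<Colon> TYPE'"
    by (rule ty_SET[OF wf_cons[OF Plus]])
  have "\<Gamma> \<turnstile> PlusRec (App (lift p) (Var 0)) (App (lift q) (Var 0)) \<Colon> Pi (Plus (App Cr P) (App Cr Q)) SET"
    by (rule ty_PlusRec[OF C]) (use ty_pred_Var[OF wf] st in simp_all)
  \<comment> \<open>The conversion takes place in \<open>TYPE'\<close>, since the codomain
    \<open>SET\<close> is not small.\<close>
  moreover have "\<Gamma> \<turnstile> Pi (Plus (App Cr P) (App Cr Q)) SET \<simeq> Pi (App Cr (SOr P Q)) SET \<Colon> TYPE'"
    by (rule eq_Pi[OF Plus eq_sym[OF eq_TYPE[OF Cr.F_SOr[OF P Q]]] eq_refl[OF C]])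
  ultimately show ?thesis by (rule ty_conv)
qed

lemma ty_pred_body_SImp:
  assumes wf: "wf_ctx \<Gamma>" and st: "stable \<Gamma> P SP" "stable \<Gamma> Q SP"
    "stable \<Gamma> p (Pi (App Cr P) SET)" "stable \<Gamma> q (Pi (App Cr Q) SET)"
  shows "App Cr (SImp P Q) # \<Gamma> \<turnstile>
    Prod (Fun (App Tp (lift P)) (App Tp (lift Q)))
      (Pi (App Cr (lift P))
        (Fun (App (lift (lift p)) (Var 0)) (App (lift (lift q)) (App (Var 1) (Var 0))))) \<Colon> SET"
proof -
  note w1 = wf_cons[OF Cr.ty_App_F[OF stable_ty[OF stable_SP(3)[OF st(1,2)] wf]]]
  note s1 = st[THEN weaken1, OF w1, simplified]
  note Tp_P = Tp.ty_App_F[OF s1(1)]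
  note L = ty_Pi[OF Tp_P Tp.ty_App_F[OF st(2)[THEN weaken2, OF wf_cons[OF Tp_P], simplified]]]
  note w2 = wf_cons[OF L]
  note s2 = st[THEN weaken2, OF w2, simplified]
  note Cr_P = Cr.ty_App_F[OF s2(1)]
  note w3 = wf_cons[OF Cr_P]
  note s3 = st[THEN weaken3, OF w3, simplified]
  note p_s = ty_pred_App[OF s3(3) ty_var'[OF w3], of 0, simplified]
  note w4 = wf_cons[OF p_s]
  note s4 = st[THEN weaken4, OF w4, simplified]
  \<comment> \<open>The realiser has index 3, below the truth component, \<open>s\<close> and the
    evidence for \<open>s\<close>; only after conversion does it have a function type.\<close>
  note r = ty_conv[OF ty_var'[OF w4, where n = "Suc (Suc (Suc 0))", simplified, OF refl] Cr.F_SImp[OF s4(1,2)]]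
  note q_rs = ty_pred_App[OF s4(4) ty_App'[OF r ty_var'[OF w4]], of "Suc 0", simplified]
  show ?thesis
    using ty_Sig[OF L ty_Pi[OF Cr_P ty_Pi[OF p_s q_rs]]] by simp
qed

lemma ty_pred_body_SAll:
  assumes wf: "wf_ctx \<Gamma>" and st: "stable \<Gamma> A SET" "stable \<Gamma> P (Pi A SP)"
    "stable \<Gamma> p (Pi A (Pi (App Cr (App (lift P) (Var 0))) SET))"
  shows "App Cr (SAll A P) # \<Gamma> \<turnstile>
    Pi (lift A) (App (App (lift (lift p)) (Var 0)) (App (Var 1) (Var 0))) \<Colon> SET"
proof -
  note w1 = wf_cons[OF Cr.ty_App_F[OF stable_ty[OF stable_SP(4)[OF st(1,2)] wf]]]
  note s1 = st[THEN weaken1, OF w1, simplified]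
  note w2 = wf_cons[OF s1(1)]
  \<comment> \<open>The computation rule of \<open>Cr\<close> at \<open>SAll\<close> works under a
    binder of its own, so it asks for stability in the extended context and not merely for
    typing.\<close>
  note c2 = st[THEN stable_Cons, THEN stable_Cons, simplified]
  note s2 = st[THEN weaken2, OF w2, simplified]
  note p_x = ty_App'[OF s2(3) ty_var'[OF w2], of 0, simplified]
  note r = ty_conv[OF ty_var'[OF w2, where n = "Suc 0", simplified, OF refl] Cr.F_SAll[OF w2 c2(1,2)]]
  note r_x = ty_App'[OF r ty_var'[OF w2], of 0, simplified]
  show ?thesis
    using ty_Pi[OF s1(1) ty_pred_App[OF p_x[OF refl] r_x[OF refl]]] by simp
qed

lemma Cr_SEx_proj:
  assumes "stable \<Gamma> A SET" "stable \<Gamma> P (Pi A SP)" "\<Gamma> \<turnstile> r \<Colon> App Cr (SEx A P)"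
  shows "\<Gamma> \<turnstile> Fst r \<Colon> A" and "\<Gamma> \<turnstile> Snd r \<Colon> App Cr (App P (Fst r))"
proof -
  note r = ty_conv[OF assms(3) Cr.F_SEx[OF has_type_wf[OF assms(3)] assms(1,2)]]
  show "\<Gamma> \<turnstile> Fst r \<Colon> A" by (rule ty_Fst[OF r])
  show "\<Gamma> \<turnstile> Snd r \<Colon> App Cr (App P (Fst r))" by (rule ty_Snd'[OF r]) simp
qed

lemma ty_pred_body_SEx:
  assumes wf: "wf_ctx \<Gamma>" and st: "stable \<Gamma> A SET" "stable \<Gamma> P (Pi A SP)"
    "stable \<Gamma> p (Pi A (Pi (App Cr (App (lift P) (Var 0))) SET))"
  shows "App Cr (SEx A P) # \<Gamma> \<turnstile> App (App (lift p) (Fst (Var 0))) (Snd (Var 0)) \<Colon> SET"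
proof -
  note w1 = wf_cons[OF Cr.ty_App_F[OF stable_ty[OF stable_SP(5)[OF st(1,2)] wf]]]
  note c1 = st[THEN stable_Cons, simplified]
  note s1 = st[THEN weaken1, OF w1, simplified]
  note r = Cr_SEx_proj[OF c1(1,2) ty_var'[OF w1, where n = 0, simplified, OF refl]]
  show ?thesis
    using ty_pred_App[OF ty_App'[OF s1(3) r(1) refl, simplified] r(2)] by simp
qed

lemma ty_pred: "\<Gamma> \<turnstile> P \<Colon> SP \<Longrightarrow> \<Gamma> \<turnstile> Pi (App Cr P) SET \<Colon> TYPE'"
  using Cr.ty_App_F ty_Pi ty_TYPE ty_SET wf_cons by blast

lemma ty_MR_motive: "wf_ctx \<Gamma> \<Longrightarrow> SP # \<Gamma> \<turnstile> Pi (App Cr (Var 0)) SET \<Colon> TYPE'"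
  by (rule ty_pred) (auto intro!: ty_var' wf_SP)

lemma ty_Lam_pred: "\<Gamma> \<turnstile> S \<Colon> SP \<Longrightarrow> App Cr S # \<Gamma> \<turnstile> t \<Colon> SET \<Longrightarrow> \<Gamma> \<turnstile> Lam t \<Colon> Pi (App Cr S) SET"
  by (rule ty_Lam[OF Cr.ty_App_F])

lemma MR_cases:
  assumes wf: "wf_ctx \<Gamma>"
  shows "sp_cases has_type \<Gamma> (Pi (App Cr (Var 0)) SET)
     (Lam Empty)
     (Lam (Var 1))
     (Lam (Prod (App (Var 2) (Fst (Var 0))) (App (Var 1) (Snd (Var 0)))))
     (PlusRec (App (Var 2) (Var 0)) (App (Var 1) (Var 0)))
     (Lam (Prod
        (Fun (App Tp (Var 4)) (App Tp (Var 3)))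
        (Pi (App Cr (Var 4))
          (Fun (App (Var 3) (Var 0)) (App (Var 2) (App (Var 1) (Var 0)))))))
     (Lam (Pi (Var 3) (App (App (Var 2) (Var 0)) (App (Var 1) (Var 0)))))
     (Lam (App (App (Var 1) (Fst (Var 0))) (Snd (Var 0))))"
    (is "sp_cases _ _ ?C ?b0 ?b1 ?b2 ?b3 ?b4 ?b5 ?b6")
proof -
  have 0: "\<Gamma> \<turnstile> ?b0 \<Colon> Pi (App Cr SBot) SET"
    by (rule ty_Lam_pred[OF ty_SBot[OF wf] ty_Empty[OF wf_cons[OF Cr.ty_App_F[OF ty_SBot[OF wf]]]]])
  have A: "SET # \<Gamma> \<turnstile> Var 0 \<Colon> SET"
    by (rule ty_var'[OF wf_SET[OF wf]]) simp_all
  have 1: "SET # \<Gamma> \<turnstile> ?b1 \<Colon> Pi (App Cr (SAtom (Var 0))) SET"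
    by (rule ty_Lam_pred[OF ty_SAtom[OF A] ty_var'[OF wf_cons[OF Cr.ty_App_F[OF ty_SAtom[OF A]]]]]) simp_all

  \<comment> \<open>The two equal-looking entries differ in meaning: in the older one
    \<open>Var 1\<close> is \<open>P\<close>, seen past \<open>Q\<close>; in the newer one it is
    \<open>Q\<close>, seen past \<open>p\<close>.\<close>
  let ?bin = "Pi (App Cr (Var 1)) SET # Pi (App Cr (Var 1)) SET # SP # SP # \<Gamma>"
  have "SP # SP # \<Gamma> \<turnstile> Var 1 \<Colon> SP"
    by (rule ty_var') (auto intro: wf wf_SP)
  from wf_cons[OF ty_pred[OF this]]
  have "Pi (App Cr (Var 1)) SET # SP # SP # \<Gamma> \<turnstile> Var 1 \<Colon> SP"
    by (intro ty_var') auto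
  from wf_cons[OF ty_pred[OF this]] have w: "wf_ctx ?bin" .
  have st: "stable ?bin (Var 3) SP" "stable ?bin (Var 2) SP"
      "stable ?bin (Var 1) (Pi (App Cr (Var 3)) SET)" "stable ?bin (Var 0) (Pi (App Cr (Var 2)) SET)"
    by (rule stable_Var; simp)+
  have 2: "?bin \<turnstile> ?b2 \<Colon> Pi (App Cr (SAnd (Var 3) (Var 2))) SET"
    using ty_Lam_pred[OF stable_ty[OF stable_SP(1)[OF st(1,2)] w] ty_pred_body_SAnd[OF w st]] by simp
  have 3: "?bin \<turnstile> ?b3 \<Colon> Pi (App Cr (SOr (Var 3) (Var 2))) SET"
    using ty_SOr_pred[OF w st] by simp
  have 4: "?bin \<turnstile> ?b4 \<Colon> Pi (App Cr (SImp (Var 3) (Var 2))) SET"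
    using ty_Lam_pred[OF stable_ty[OF stable_SP(3)[OF st(1,2)] w] ty_pred_body_SImp[OF w st]] by simp

  let ?quant = "Pi (Var 1) (Pi (App Cr (App (Var 1) (Var 0))) SET) # Pi (Var 0) SP # SET # \<Gamma>"
  have "wf_ctx (Pi (Var 0) SP # SET # \<Gamma>)"
    by (rule wf_cons[OF ty_Pi[OF ty_TYPE[OF A] ty_SP[OF wf_cons[OF A]]]])
  then have A': "Pi (Var 0) SP # SET # \<Gamma> \<turnstile> Var 1 \<Colon> SET"
    by (intro ty_var') simp_all
  have "Var 1 # Pi (Var 0) SP # SET # \<Gamma> \<turnstile> App (Var 1) (Var 0) \<Colon> SP"
    by (rule ty_App'[where A = "Var 2" and B = SP]) (use wf_cons[OF A'] in \<open>auto intro!: ty_var'\<close>)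
  from wf_cons[OF ty_Pi[OF ty_TYPE[OF A'] ty_pred[OF this]]]
  have w': "wf_ctx ?quant" .
  have st': "stable ?quant (Var 2) SET" "stable ?quant (Var 1) (Pi (Var 2) SP)"
      "stable ?quant (Var 0) (Pi (Var 2) (Pi (App Cr (App (lift (Var 1)) (Var 0))) SET))"
    by (rule stable_Var; simp)+
  have 5: "?quant \<turnstile> ?b5 \<Colon> Pi (App Cr (SAll (Var 2) (Var 1))) SET"
    using ty_Lam_pred[OF stable_ty[OF stable_SP(4)[OF st'(1,2)] w'] ty_pred_body_SAll[OF w' st']] by simp
  have 6: "?quant \<turnstile> ?b6 \<Colon> Pi (App Cr (SEx (Var 2) (Var 1))) SET"
    using ty_Lam_pred[OF stable_ty[OF stable_SP(5)[OF st'(1,2)] w'] ty_pred_body_SEx[OF w' st']] by simp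
  show ?thesis
    using 0 1 2 3 4 5 6 by simp
qed

section \<open>Typing and computation rules of \<open>MR\<close>\<close>

lemma ty_MR: "wf_ctx \<Gamma> \<Longrightarrow> \<Gamma> \<turnstile> MR \<Colon> Pi SP (Pi (App Cr (Var 0)) SET)"
  unfolding MR_def by (rule ty_SPRec[OF ty_MR_motive MR_cases])

lemma stable_MR: "stable \<Gamma> P SP \<Longrightarrow> stable \<Gamma> (App MR P) (Pi (App Cr P) SET)"
  by (rule stable_App[where A = SP and B = "Pi (App Cr (Var 0)) SET"])
    (simp_all add: stable_def ty_MR)

lemma ty_MR_App: "\<Gamma> \<turnstile> S \<Colon> SP \<Longrightarrow> \<Gamma> \<turnstile> App MR S \<Colon> Pi (App Cr S) SET"
  by (rule ty_App'[OF ty_MR]) (auto intro: has_type_wf)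

lemma ty_MR_App2: "\<Gamma> \<turnstile> S \<Colon> SP \<Longrightarrow> \<Gamma> \<turnstile> r \<Colon> App Cr S \<Longrightarrow> \<Gamma> \<turnstile> App (App MR S) r \<Colon> SET"
  using ty_pred_App ty_MR_App by blast

text \<open>Every clause except the one for \<open>SOr\<close> is a \<open>Lam\<close>, so its
  computation rule is the recursor step \<open>eq\<close>, applied to \<open>r\<close>, followed by
  one contraction. The premise \<open>t\<close> is where the lemmas on clause bodies are used
  again.\<close>

lemma MR_beta:
  assumes S: "\<Gamma> \<turnstile> S \<Colon> SP" and r: "\<Gamma> \<turnstile> r \<Colon> App Cr S"
    and eq: "\<Gamma> \<turnstile> App MR S \<simeq> Lam t \<Colon> Pi (App Cr S) SET" and t: "App Cr S # \<Gamma> \<turnstile> t \<Colon> SET"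
  shows "\<Gamma> \<turnstile> App (App MR S) r \<simeq> inst t r \<Colon> SET"
proof (rule eq_trans)
  show "\<Gamma> \<turnstile> App (App MR S) r \<simeq> App (Lam t) r \<Colon> SET"
    by (rule eq_App'[OF eq r]) simp
  show "\<Gamma> \<turnstile> App (Lam t) r \<simeq> inst t r \<Colon> SET"
    by (rule eq_beta'[OF Cr.ty_App_F[OF S] t r]) simp_all
qed

lemma MR_SBot:
  assumes r: "\<Gamma> \<turnstile> r \<Colon> App Cr SBot"
  shows "\<Gamma> \<turnstile> App (App MR SBot) r \<simeq> Empty \<Colon> SET"
proof -
  note wf = has_type_wf[OF r]
  note S = ty_SBot[OF wf]
  show ?thesis
    using MR_beta[OF S r _ ty_Empty[OF wf_cons[OF Cr.ty_App_F[OF S]]]]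
      eq_SPRec_SBot[OF ty_MR_motive[OF wf] MR_cases[OF wf], folded MR_def] by simp
qed

lemma MR_SAtom:
  assumes wf: "wf_ctx \<Gamma>" and A: "stable \<Gamma> A SET" and r: "\<Gamma> \<turnstile> r \<Colon> App Cr (SAtom A)"
  shows "\<Gamma> \<turnstile> App (App MR (SAtom A)) r \<simeq> A \<Colon> SET"
proof -
  note tA = stable_ty[OF A wf]
  note S = ty_SAtom[OF tA]
  show ?thesis
    using MR_beta[OF S r _ weaken1[OF A wf_cons[OF Cr.ty_App_F[OF S]], simplified]]
      eq_SPRec_SAtom[OF ty_MR_motive[OF wf] MR_cases[OF wf] tA, folded MR_def] by simp
qed

lemma MR_SAnd:
  assumes st: "stable \<Gamma> P SP" "stable \<Gamma> Q SP" and r: "\<Gamma> \<turnstile> r \<Colon> App Cr (SAnd P Q)"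
  shows "\<Gamma> \<turnstile> App (App MR (SAnd P Q)) r \<simeq> Prod (App (App MR P) (Fst r)) (App (App MR Q) (Snd r)) \<Colon> SET"
proof -
  note wf = has_type_wf[OF r]
  note PQ = st[THEN stable_ty, OF wf]
  show ?thesis
    using MR_beta[OF ty_SAnd[OF PQ] r _ ty_pred_body_SAnd[OF wf st st[THEN stable_MR]]]
      eq_SPRec_SAnd[OF ty_MR_motive[OF wf] MR_cases[OF wf] PQ MR_def] by simp
qed

lemma MR_SImp:
  assumes st: "stable \<Gamma> P SP" "stable \<Gamma> Q SP" and r: "\<Gamma> \<turnstile> r \<Colon> App Cr (SImp P Q)"
  shows "\<Gamma> \<turnstile> App (App MR (SImp P Q)) r \<simeq>
    Prod (Fun (App Tp P) (App Tp Q))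
      (Pi (App Cr P)
        (Fun (App (App MR (lift P)) (Var 0)) (App (App MR (lift Q)) (App (lift r) (Var 0))))) \<Colon> SET"
proof -
  note wf = has_type_wf[OF r]
  note PQ = st[THEN stable_ty, OF wf]
  show ?thesis
    using MR_beta[OF ty_SImp[OF PQ] r _ ty_pred_body_SImp[OF wf st st[THEN stable_MR]]]
      eq_SPRec_SImp[OF ty_MR_motive[OF wf] MR_cases[OF wf] PQ MR_def] by simp
qed

text \<open>For a variable realiser of a disjunction \<open>MR\<close> does not compute; only
  injections make the \<open>PlusRec\<close> in its clause reduce. This forces the case distinction
  in \<open>truth_SOr\<close>.\<close>

lemma
  assumes wf: "wf_ctx \<Gamma>" and st: "stable \<Gamma> P SP" "stable \<Gamma> Q SP"
  shows MR_SOr_InL: "\<And>s. \<Gamma> \<turnstile> s \<Colon> App Cr P \<Longrightarrow> \<Gamma> \<turnstile> App (App MR (SOr P Q)) (InL s) \<simeq> App (App MR P) s \<Colon> SET"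
    and MR_SOr_InR: "\<And>s. \<Gamma> \<turnstile> s \<Colon> App Cr Q \<Longrightarrow> \<Gamma> \<turnstile> App (App MR (SOr P Q)) (InR s) \<simeq> App (App MR Q) s \<Colon> SET"
proof -
  note PQ = st[THEN stable_ty, OF wf]
  note Cr_P = Cr.ty_App_F[OF PQ(1)] and Cr_Q = Cr.ty_App_F[OF PQ(2)]
  let ?c = "App (lift (App MR P)) (Var 0)" and ?d = "App (lift (App MR Q)) (Var 0)"
  have eq: "\<Gamma> \<turnstile> App MR (SOr P Q) \<simeq> PlusRec ?c ?d \<Colon> Pi (App Cr (SOr P Q)) SET"
    using eq_SPRec_SOr[OF ty_MR_motive[OF wf] MR_cases[OF wf] PQ MR_def] by simp
  have C: "Plus (App Cr P) (App Cr Q) # \<Gamma> \<turnstile> SET \<Colon> TYPE'"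
    by (rule ty_SET[OF wf_cons[OF ty_Plus[OF Cr_P Cr_Q]]])
  have c: "App Cr P # \<Gamma> \<turnstile> ?c \<Colon> insts 1 [InL (Var 0)] SET"
    and d: "App Cr Q # \<Gamma> \<turnstile> ?d \<Colon> insts 1 [InR (Var 0)] SET"
    using ty_pred_Var[OF wf st(1) stable_MR[OF st(1)]] ty_pred_Var[OF wf st(2) stable_MR[OF st(2)]] by simp_all
  show "\<Gamma> \<turnstile> App (App MR (SOr P Q)) (InL s) \<simeq> App (App MR P) s \<Colon> SET" if s: "\<Gamma> \<turnstile> s \<Colon> App Cr P" for s
  proof (rule eq_trans)
    show "\<Gamma> \<turnstile> App (App MR (SOr P Q)) (InL s) \<simeq> App (PlusRec ?c ?d) (InL s) \<Colon> SET"
      by (rule eq_App'[OF eq Cr.InL[OF PQ s]]) simp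
    show "\<Gamma> \<turnstile> App (PlusRec ?c ?d) (InL s) \<simeq> App (App MR P) s \<Colon> SET"
      using eq_PlusRec_InL[OF C c d s] by simp
  qed
  show "\<Gamma> \<turnstile> App (App MR (SOr P Q)) (InR s) \<simeq> App (App MR Q) s \<Colon> SET" if s: "\<Gamma> \<turnstile> s \<Colon> App Cr Q" for s
  proof (rule eq_trans)
    show "\<Gamma> \<turnstile> App (App MR (SOr P Q)) (InR s) \<simeq> App (PlusRec ?c ?d) (InR s) \<Colon> SET"
      by (rule eq_App'[OF eq Cr.InR[OF PQ s]]) simp
    show "\<Gamma> \<turnstile> App (PlusRec ?c ?d) (InR s) \<simeq> App (App MR Q) s \<Colon> SET"
      using eq_PlusRec_InR[OF C c d s] by simp
  qed
qed

lemma ty_MR_family: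
  assumes A: "stable \<Gamma> A SET" and P: "stable \<Gamma> P (Pi A SP)" and wf: "wf_ctx \<Gamma>"
  shows "A # \<Gamma> \<turnstile> App MR (App (lift P) (Var 0)) \<Colon> Pi (App Cr (App (lift P) (Var 0))) SET"
proof -
  note w = wf_cons[OF stable_ty[OF A wf]]
  show ?thesis
    by (rule ty_MR_App[OF ty_App'[where A = "lift A" and B = SP]])
      (use weaken1[OF P w] w in \<open>auto intro!: ty_var'\<close>)
qed

text \<open>This \<open>Lam\<close> is the term that the recursor supplies for \<open>p\<close> in
  the quantifier clauses; its stability makes the lemmas on their bodies applicable to it.\<close>

lemma stable_MR_family:
  assumes A: "stable \<Gamma> A SET" and P: "stable \<Gamma> P (Pi A SP)"
  shows "stable \<Gamma> (Lam (App MR (App (lift P) (Var 0)))) (Pi A (Pi (App Cr (App (lift P) (Var 0))) SET))"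
  unfolding stable_def
proof (intro allI impI)
  fix \<Delta>
  assume wf: "wf_ctx (\<Delta> @ \<Gamma>)"
  note A' = stable_append[OF A, of \<Delta>, simplified]
  note P' = stable_append[OF P, of \<Delta>, simplified]
  show "\<Delta> @ \<Gamma> \<turnstile> insts (length \<Delta>) [] (Lam (App MR (App (lift P) (Var 0))))
      \<Colon> insts (length \<Delta>) [] (Pi A (Pi (App Cr (App (lift P) (Var 0))) SET))"
    using ty_Lam[OF stable_ty[OF A' wf] ty_MR_family[OF A' P' wf]] by simp
qed

lemma MR_family_beta:
  assumes wf: "wf_ctx \<Gamma>" and A: "stable \<Gamma> A SET" and P: "stable \<Gamma> P (Pi A SP)" and x: "\<Gamma> \<turnstile> x \<Colon> A"
    and u: "\<Gamma> \<turnstile> u \<Colon> App Cr (App P x)"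
  shows "\<Gamma> \<turnstile> App (App (Lam (App MR (App (lift P) (Var 0)))) x) u \<simeq> App (App MR (App P x)) u \<Colon> SET"
proof (rule eq_App'[OF _ u])
  show "\<Gamma> \<turnstile> App (Lam (App MR (App (lift P) (Var 0)))) x \<simeq> App MR (App P x) \<Colon> Pi (App Cr (App P x)) SET"
    by (rule eq_beta'[OF stable_ty[OF A wf] ty_MR_family[OF A P wf] x]) simp_all
qed simp

text \<open>The redex left by the recursor lies under the binder of \<open>Pi\<close>, where
  \<open>r\<close> is applied to the bound variable. Contracting it requires \<open>r\<close> to be
  typed in \<open>A # \<Gamma>\<close>, hence the stability of \<open>r\<close>.\<close>

lemma MR_SAll:
  assumes wf: "wf_ctx \<Gamma>" and A: "stable \<Gamma> A SET" and P: "stable \<Gamma> P (Pi A SP)"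
    and r: "stable \<Gamma> r (App Cr (SAll A P))"
  shows "\<Gamma> \<turnstile> App (App MR (SAll A P)) r \<simeq>
    Pi A (App (App MR (App (lift P) (Var 0))) (App (lift r) (Var 0))) \<Colon> SET"
proof -
  let ?p = "Lam (App MR (App (lift P) (Var 0)))"
  note tA = stable_ty[OF A wf] and tr = stable_ty[OF r wf]
  have P_Fun: "\<Gamma> \<turnstile> P \<Colon> Fun A SP"
    using stable_ty[OF P wf] by simp
  have 1: "\<Gamma> \<turnstile> App (App MR (SAll A P)) r \<simeq> Pi A (App (App (lift ?p) (Var 0)) (App (lift r) (Var 0))) \<Colon> SET"
    using MR_beta[OF ty_SAll[OF tA P_Fun] tr _ ty_pred_body_SAll[OF wf A P stable_MR_family[OF A P]]]
      eq_SPRec_SAll[OF ty_MR_motive[OF wf] MR_cases[OF wf] tA P_Fun MR_def] by simp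
  note w1 = wf_cons[OF tA]
  note A1 = stable_Cons[OF A, simplified] and P1 = stable_Cons[OF P, simplified]
  have x: "A # \<Gamma> \<turnstile> Var 0 \<Colon> lift A"
    by (rule ty_var'[OF w1]) simp_all
  note r1 = ty_conv[OF weaken1[OF r w1, simplified] Cr.F_SAll[OF w1 A1 P1]]
  note rx = ty_App'[OF r1 x[simplified] refl, simplified]
  have 2: "A # \<Gamma> \<turnstile> App (App (lift ?p) (Var 0)) (App (lift r) (Var 0))
      \<simeq> App (App MR (App (lift P) (Var 0))) (App (lift r) (Var 0)) \<Colon> SET"
    using MR_family_beta[OF w1 A1 P1 x[simplified] rx] by simp
  show ?thesis
    by (rule eq_trans[OF 1 eq_Pi[OF tA eq_refl[OF tA] 2]])
qed

lemma MR_SEx: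
  assumes A: "stable \<Gamma> A SET" and P: "stable \<Gamma> P (Pi A SP)" and r: "\<Gamma> \<turnstile> r \<Colon> App Cr (SEx A P)"
  shows "\<Gamma> \<turnstile> App (App MR (SEx A P)) r \<simeq> App (App MR (App P (Fst r))) (Snd r) \<Colon> SET"
proof -
  let ?p = "Lam (App MR (App (lift P) (Var 0)))"
  note wf = has_type_wf[OF r]
  note tA = stable_ty[OF A wf]
  have P_Fun: "\<Gamma> \<turnstile> P \<Colon> Fun A SP"
    using stable_ty[OF P wf] by simp
  have 1: "\<Gamma> \<turnstile> App (App MR (SEx A P)) r \<simeq> App (App ?p (Fst r)) (Snd r) \<Colon> SET"
    using MR_beta[OF ty_SEx[OF tA P_Fun] r _ ty_pred_body_SEx[OF wf A P stable_MR_family[OF A P]]]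
      eq_SPRec_SEx[OF ty_MR_motive[OF wf] MR_cases[OF wf] tA P_Fun MR_def] by simp
  show ?thesis
    by (rule eq_trans[OF 1 MR_family_beta[OF wf A P Cr_SEx_proj[OF A P r]]])
qed


section \<open>Realisability implies truth\<close>

text \<open>The motive of the final recursion, with its argument left open because the contexts of
  the cases contain it at \<open>P\<close>, \<open>Q\<close> and \<open>P x\<close>.\<close>

abbreviation truth :: "tm \<Rightarrow> tm" where
  "truth S \<equiv> Pi (App Cr S) (Fun (App (App MR (lift S)) (Var 0)) (App Tp (lift S)))"

lemma ty_MR_Var:
  assumes "wf_ctx \<Gamma>" "stable \<Gamma> S SP"
  shows "App Cr S # \<Gamma> \<turnstile> App (App MR (lift S)) (Var 0) \<Colon> SET"
  using ty_pred_Var[OF assms stable_MR[OF assms(2)]] by simp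

lemma ty_truth:
  assumes wf: "wf_ctx \<Gamma>" and S: "stable \<Gamma> S SP"
  shows "\<Gamma> \<turnstile> truth S \<Colon> SET"
proof -
  note MR = ty_MR_Var[OF wf S]
  show ?thesis
    using ty_Pi[OF Cr.ty_App_F[OF stable_ty[OF S wf]]
      ty_Pi[OF MR[simplified] Tp.ty_App_F[OF weaken2[OF S wf_cons[OF MR], simplified]]]]
    by simp
qed

text \<open>Well-formedness of the context with realiser and evidence is handed to the premise
  \<open>t\<close>, so that each clause obtains it for free.\<close>

lemma truth_intro:
  assumes wf: "wf_ctx \<Gamma>" and S: "stable \<Gamma> S SP"
    and t: "wf_ctx (App (App MR (lift S)) (Var 0) # App Cr S # \<Gamma>) \<Longrightarrow>
      App (App MR (lift S)) (Var 0) # App Cr S # \<Gamma> \<turnstile> t \<Colon> App Tp (lift (lift S))"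
  shows "\<Gamma> \<turnstile> Lam (Lam t) \<Colon> truth S"
proof -
  note MR = ty_MR_Var[OF wf S]
  show ?thesis
    using ty_Lam[OF Cr.ty_App_F[OF stable_ty[OF S wf]] ty_Lam[OF MR t[OF wf_cons[OF MR]]]] by simp
qed

lemma truth_elim:
  assumes p: "\<Gamma> \<turnstile> p \<Colon> truth S" and r: "\<Gamma> \<turnstile> r \<Colon> App Cr S" and m: "\<Gamma> \<turnstile> m \<Colon> App (App MR S) r"
  shows "\<Gamma> \<turnstile> App (App p r) m \<Colon> App Tp S"
  by (rule ty_App'[OF ty_App'[OF p r refl, simplified] m]) simp

section \<open>Evidence terms for the seven clauses\<close>

lemma truth_SBot:
  assumes wf: "wf_ctx \<Gamma>"
  shows "\<Gamma> \<turnstile> Lam (Lam (Var 0)) \<Colon> truth SBot"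
proof (rule truth_intro[OF wf])
  show "stable \<Gamma> SBot SP"
    by (simp add: stable_def ty_SBot)
  let ?\<Gamma> = "App (App MR (lift SBot)) (Var 0) # App Cr SBot # \<Gamma>"
  assume w: "wf_ctx ?\<Gamma>"
  have r: "?\<Gamma> \<turnstile> Var 1 \<Colon> App Cr SBot" and m: "?\<Gamma> \<turnstile> Var 0 \<Colon> App (App MR SBot) (Var 1)"
    by (rule ty_var'[OF w]; simp)+
  show "?\<Gamma> \<turnstile> Var 0 \<Colon> App Tp (lift (lift SBot))"
    using ty_conv[OF ty_conv[OF m MR_SBot[OF r]] eq_sym[OF Tp.F_SBot[OF w]]] by simp
qed

text \<open>As for \<open>SBot\<close>, the types of the given evidence and of the wanted element
  compute to the same type, so the evidence is returned unchanged.\<close>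

lemma truth_SAtom:
  assumes wf: "wf_ctx \<Gamma>" and A: "stable \<Gamma> A SET"
  shows "\<Gamma> \<turnstile> Lam (Lam (Var 0)) \<Colon> truth (SAtom A)"
proof (rule truth_intro[OF wf])
  show "stable \<Gamma> (SAtom A) SP"
    using A by (simp add: stable_def ty_SAtom)
  let ?\<Gamma> = "App (App MR (lift (SAtom A))) (Var 0) # App Cr (SAtom A) # \<Gamma>"
  let ?A = "insts 2 [] A"
  assume w: "wf_ctx ?\<Gamma>"
  have r: "?\<Gamma> \<turnstile> Var 1 \<Colon> App Cr (SAtom ?A)" and m: "?\<Gamma> \<turnstile> Var 0 \<Colon> App (App MR (SAtom ?A)) (Var 1)"
    by (rule ty_var'[OF w]; simp)+
  have A': "stable ?\<Gamma> ?A SET"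
    using stable_Cons[OF stable_Cons[OF A]] by simp
  have "?\<Gamma> \<turnstile> App Tp (SAtom ?A) \<simeq> ?A \<Colon> SET"
    using Tp.F_SAtom[OF stable_ty[OF A' w]] by simp
  then show "?\<Gamma> \<turnstile> Var 0 \<Colon> App Tp (lift (lift (SAtom A)))"
    using ty_conv[OF ty_conv[OF m MR_SAtom[OF w A' r]] eq_sym] by simp
qed

text \<open>In the term \<open>Var 1\<close> is the realiser and \<open>Var 0\<close> the evidence.
  Conversion along \<open>Cr\<close> and \<open>MR\<close> makes pairs of both, and the recursive
  values \<open>p\<close>, \<open>q\<close> are applied to matching components.\<close>

lemma truth_SAnd:
  assumes wf: "wf_ctx \<Gamma>" and st: "stable \<Gamma> P SP" "stable \<Gamma> Q SP"
    "stable \<Gamma> p (truth P)" "stable \<Gamma> q (truth Q)"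
  shows "\<Gamma> \<turnstile> Lam (Lam (Pair (App (App (lift (lift p)) (Fst (Var 1))) (Fst (Var 0)))
    (App (App (lift (lift q)) (Snd (Var 1))) (Snd (Var 0))))) \<Colon> truth (SAnd P Q)"
proof (rule truth_intro[OF wf stable_SP(1)[OF st(1,2)]])
  let ?\<Gamma> = "App (App MR (lift (SAnd P Q))) (Var 0) # App Cr (SAnd P Q) # \<Gamma>"
  let ?P = "insts 2 [] P" and ?Q = "insts 2 [] Q"
  assume w: "wf_ctx ?\<Gamma>"
  have st': "stable ?\<Gamma> ?P SP" "stable ?\<Gamma> ?Q SP"
    "stable ?\<Gamma> (lift (lift p)) (truth ?P)" "stable ?\<Gamma> (lift (lift q)) (truth ?Q)"
    using st[THEN stable_Cons, THEN stable_Cons] by simp_all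
  note ty = st'[THEN stable_ty, OF w]
  have r: "?\<Gamma> \<turnstile> Var 1 \<Colon> App Cr (SAnd ?P ?Q)"
    and m: "?\<Gamma> \<turnstile> Var 0 \<Colon> App (App MR (SAnd ?P ?Q)) (Var 1)"
    by (rule ty_var'[OF w]; simp)+
  note r' = Cr_SAnd_proj[OF ty(1,2) r]
  note m' = ty_conv[OF m MR_SAnd[OF st'(1,2) r]]
  note Tp_P = Tp.ty_App_F[OF ty(1)]
  have Tp_Q: "App Tp ?P # ?\<Gamma> \<turnstile> lift (App Tp ?Q) \<Colon> SET"
    using Tp.ty_App_F[OF weaken1[OF st'(2) wf_cons[OF Tp_P], simplified]] by simp
  note p = truth_elim[OF ty(3) r'(1) ty_Fst[OF m']]
  have "?\<Gamma> \<turnstile> Snd (Var 0) \<Colon> App (App MR ?Q) (Snd (Var 1))"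
    by (rule ty_Snd'[OF m']) simp
  note q = truth_elim[OF ty(4) r'(2) this]
  have "?\<Gamma> \<turnstile> Pair (App (App (lift (lift p)) (Fst (Var 1))) (Fst (Var 0)))
      (App (App (lift (lift q)) (Snd (Var 1))) (Snd (Var 0))) \<Colon> Prod (App Tp ?P) (App Tp ?Q)"
    by (rule ty_Pair[OF Tp_P Tp_Q p]) (use q in simp)
  from ty_conv[OF this eq_sym[OF Tp.F_SAnd[OF ty(1,2)]]]
  show "?\<Gamma> \<turnstile> Pair (App (App (lift (lift p)) (Fst (Var 1))) (Fst (Var 0)))
      (App (App (lift (lift q)) (Snd (Var 1))) (Snd (Var 0))) \<Colon> App Tp (lift (lift (SAnd P Q)))"
    by simp
qed

text \<open>Both branches at once: \<open>con\<close> is \<open>InL\<close> or \<open>InR\<close>,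
  \<open>P\<close> the chosen disjunct, \<open>S\<close> the disjunction. The facts about
  \<open>con\<close> range over extensions \<open>\<Delta>\<close> because they are used under one
  or two further variables. As \<open>con\<close> is a function on raw terms, its compatibility with
  lifting has to be assumed.\<close>

lemma truth_SOr_branch:
  assumes wf: "wf_ctx \<Gamma>" and st: "stable \<Gamma> P SP" "stable \<Gamma> p (truth P)" "stable \<Gamma> S SP"
    and inj: "\<And>\<Delta> s. wf_ctx (\<Delta> @ \<Gamma>) \<Longrightarrow> \<Delta> @ \<Gamma> \<turnstile> s \<Colon> App Cr (insts (length \<Delta>) [] P)
      \<Longrightarrow> \<Delta> @ \<Gamma> \<turnstile> con s \<Colon> App Cr (insts (length \<Delta>) [] S)"
    and MR: "\<And>\<Delta> s. wf_ctx (\<Delta> @ \<Gamma>) \<Longrightarrow> \<Delta> @ \<Gamma> \<turnstile> s \<Colon> App Cr (insts (length \<Delta>) [] P)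
      \<Longrightarrow> \<Delta> @ \<Gamma> \<turnstile> App (App MR (insts (length \<Delta>) [] S)) (con s)
        \<simeq> App (App MR (insts (length \<Delta>) [] P)) s \<Colon> SET"
    and Tp: "\<And>\<Delta> a. wf_ctx (\<Delta> @ \<Gamma>) \<Longrightarrow> \<Delta> @ \<Gamma> \<turnstile> a \<Colon> App Tp (insts (length \<Delta>) [] P)
      \<Longrightarrow> \<Delta> @ \<Gamma> \<turnstile> con a \<Colon> App Tp (insts (length \<Delta>) [] S)"
    and lift_con: "lift (con (Var 0)) = con (Var 1)"
  shows "App Cr P # \<Gamma> \<turnstile> Lam (con (App (App (lift (lift p)) (Var 1)) (Var 0)))
    \<Colon> Fun (App (App MR (lift S)) (con (Var 0))) (App Tp (lift S))"
proof -
  let ?m = "App (App MR (lift S)) (con (Var 0))"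
  note w1 = wf_cons[OF Cr.ty_App_F[OF stable_ty[OF st(1) wf]]]
  have s1: "App Cr P # \<Gamma> \<turnstile> Var 0 \<Colon> App Cr (lift P)"
    by (rule ty_var'[OF w1]) simp_all
  have m1: "App Cr P # \<Gamma> \<turnstile> ?m \<Colon> SET"
    using ty_MR_App2[OF weaken1[OF st(3) w1, simplified] inj[of "[App Cr P]" "Var 0", simplified, OF w1 s1[simplified]]]
    by simp
  let ?\<Gamma> = "?m # App Cr P # \<Gamma>"
  note w2 = wf_cons[OF m1]
  have s2: "?\<Gamma> \<turnstile> Var 1 \<Colon> App Cr (insts 2 [] P)"
    by (rule ty_var'[OF w2]) simp_all
  have m2: "?\<Gamma> \<turnstile> Var 0 \<Colon> App (App MR (insts 2 [] S)) (con (Var 1))"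
    by (rule ty_var'[OF w2]) (use lift_con in simp_all)
  have "?\<Gamma> \<turnstile> App (App MR (insts 2 [] S)) (con (Var 1)) \<simeq> App (App MR (insts 2 [] P)) (Var 1) \<Colon> SET"
    using MR[of "[?m, App Cr P]" "Var 1"] w2 s2 by simp
  note m2' = ty_conv[OF m2 this]
  have p2: "?\<Gamma> \<turnstile> lift (lift p) \<Colon> truth (insts 2 [] P)"
    using weaken2[OF st(2) w2] by simp
  have "?\<Gamma> \<turnstile> con (App (App (lift (lift p)) (Var 1)) (Var 0)) \<Colon> App Tp (insts 2 [] S)"
    using Tp[of "[?m, App Cr P]"] truth_elim[OF p2 s2 m2'] w2 by simp
  with m1 show ?thesis
    by (intro ty_Lam) simp_all
qed

text \<open>The evidence is abstracted inside the branches, not before the case distinction: the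
  motive \<open>?C\<close> contains the implication from \<open>MR\<close> to \<open>Tp\<close>, so
  in each branch the type of the evidence mentions an injection and computes.\<close>

lemma truth_SOr:
  assumes wf: "wf_ctx \<Gamma>" and st: "stable \<Gamma> P SP" "stable \<Gamma> Q SP"
    "stable \<Gamma> p (truth P)" "stable \<Gamma> q (truth Q)"
  shows "\<Gamma> \<turnstile> PlusRec (Lam (InL (App (App (lift (lift p)) (Var 1)) (Var 0))))
    (Lam (InR (App (App (lift (lift q)) (Var 1)) (Var 0)))) \<Colon> truth (SOr P Q)"
proof -
  let ?S = "SOr P Q"
  let ?C = "Fun (App (App MR (lift ?S)) (Var 0)) (App Tp (lift ?S))"
  note S = stable_SP(2)[OF st(1,2)]
  note PQ = st(1,2)[THEN stable_ty, OF wf]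
  note Cr_P = Cr.ty_App_F[OF PQ(1)] and Cr_Q = Cr.ty_App_F[OF PQ(2)]
  note Plus = ty_Plus[OF Cr_P Cr_Q]
  let ?\<Gamma> = "Plus (App Cr P) (App Cr Q) # \<Gamma>"
  note w1 = wf_cons[OF Plus]
  have r: "?\<Gamma> \<turnstile> Var 0 \<Colon> Plus (App Cr (lift P)) (App Cr (lift Q))"
    by (rule ty_var'[OF w1]) simp_all
  \<comment> \<open>\<open>PlusRec\<close> wants its motive over the sum, whereas \<open>MR\<close>
    expects a crude element of the disjunction, so the variable is converted back.\<close>
  have "?\<Gamma> \<turnstile> Var 0 \<Colon> App Cr (lift ?S)"
    using ty_conv[OF r[simplified] eq_sym[OF Cr.F_SOr[OF st(1,2)[THEN weaken1, OF w1, simplified]]]] by simp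
  from ty_MR_App2[OF weaken1[OF S w1, simplified] this[simplified]]
  have m: "?\<Gamma> \<turnstile> App (App MR (lift ?S)) (Var 0) \<Colon> SET" by simp
  have C: "?\<Gamma> \<turnstile> ?C \<Colon> SET"
    using ty_Pi[OF m[simplified] Tp.ty_App_F[OF weaken2[OF S wf_cons[OF m], simplified]]] by simp
  have ext: "\<Delta> @ \<Gamma> \<turnstile> insts (length \<Delta>) [] P \<Colon> SP" "\<Delta> @ \<Gamma> \<turnstile> insts (length \<Delta>) [] Q \<Colon> SP"
    if "wf_ctx (\<Delta> @ \<Gamma>)" for \<Delta>
    using st(1,2) that unfolding stable_def by simp_all
  have "App Cr P # \<Gamma> \<turnstile> Lam (InL (App (App (lift (lift p)) (Var 1)) (Var 0)))
    \<Colon> Fun (App (App MR (lift ?S)) (InL (Var 0))) (App Tp (lift ?S))"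
    by (rule truth_SOr_branch[OF wf st(1,3) S])
      (simp_all add: Cr.InL Tp.InL ext MR_SOr_InL
        stable_append[OF st(1), simplified] stable_append[OF st(2), simplified])
  moreover have "App Cr Q # \<Gamma> \<turnstile> Lam (InR (App (App (lift (lift q)) (Var 1)) (Var 0)))
    \<Colon> Fun (App (App MR (lift ?S)) (InR (Var 0))) (App Tp (lift ?S))"
    by (rule truth_SOr_branch[OF wf st(2,4) S])
      (simp_all add: Cr.InR Tp.InR ext MR_SOr_InR
        stable_append[OF st(1), simplified] stable_append[OF st(2), simplified])
  ultimately have "\<Gamma> \<turnstile> PlusRec (Lam (InL (App (App (lift (lift p)) (Var 1)) (Var 0))))
    (Lam (InR (App (App (lift (lift q)) (Var 1)) (Var 0)))) \<Colon> Pi (Plus (App Cr P) (App Cr Q)) ?C"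
    by (intro ty_PlusRec[OF C]) simp_all
  moreover have "\<Gamma> \<turnstile> Pi (Plus (App Cr P) (App Cr Q)) ?C \<simeq> truth ?S \<Colon> SET"
    by (rule eq_Pi[OF Plus eq_sym[OF Cr.F_SOr[OF PQ]] eq_refl[OF C]])
  ultimately show ?thesis by (rule ty_conv)
qed

lemma truth_SImp:
  assumes wf: "wf_ctx \<Gamma>" and st: "stable \<Gamma> P SP" "stable \<Gamma> Q SP"
  shows "\<Gamma> \<turnstile> Lam (Lam (Fst (Var 0))) \<Colon> truth (SImp P Q)"
proof (rule truth_intro[OF wf stable_SP(3)[OF st]])
  let ?\<Gamma> = "App (App MR (lift (SImp P Q))) (Var 0) # App Cr (SImp P Q) # \<Gamma>"
  let ?P = "insts 2 [] P" and ?Q = "insts 2 [] Q"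
  assume w: "wf_ctx ?\<Gamma>"
  have st': "stable ?\<Gamma> ?P SP" "stable ?\<Gamma> ?Q SP"
    using st[THEN stable_Cons, THEN stable_Cons] by simp_all
  have r: "?\<Gamma> \<turnstile> Var 1 \<Colon> App Cr (SImp ?P ?Q)"
    and m: "?\<Gamma> \<turnstile> Var 0 \<Colon> App (App MR (SImp ?P ?Q)) (Var 1)"
    by (rule ty_var'[OF w]; simp)+
  from ty_conv[OF ty_Fst[OF ty_conv[OF m MR_SImp[OF st' r]]] eq_sym[OF Tp.F_SImp[OF st'[THEN stable_ty, OF w]]]]
  show "?\<Gamma> \<turnstile> Fst (Var 0) \<Colon> App Tp (lift (lift (SImp P Q)))"
    by simp
qed

text \<open>Under the three abstractions \<open>Var 2\<close> is the realiser, \<open>Var 1\<close>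
  the evidence and \<open>Var 0\<close> the point \<open>x\<close>; the recursive value at
  \<open>x\<close> is applied to the values of both at \<open>x\<close>.\<close>

lemma truth_SAll:
  assumes wf: "wf_ctx \<Gamma>" and st: "stable \<Gamma> A SET" "stable \<Gamma> P (Pi A SP)"
    "stable \<Gamma> p (Pi A (truth (App (lift P) (Var 0))))"
  shows "\<Gamma> \<turnstile> Lam (Lam (Lam (App (App (App (insts 3 [] p) (Var 0)) (App (Var 2) (Var 0))) (App (Var 1) (Var 0)))))
    \<Colon> truth (SAll A P)"
proof (rule truth_intro[OF wf stable_SP(4)[OF st(1,2)]])
  let ?\<Gamma> = "App (App MR (lift (SAll A P))) (Var 0) # App Cr (SAll A P) # \<Gamma>"
  let ?A = "insts 2 [] A" and ?P = "insts 2 [] P"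
  let ?t = "App (App (App (insts 3 [] p) (Var 0)) (App (Var 2) (Var 0))) (App (Var 1) (Var 0))"
  assume w: "wf_ctx ?\<Gamma>"
  have st2: "stable ?\<Gamma> ?A SET" "stable ?\<Gamma> ?P (Pi ?A SP)"
    using st(1,2)[THEN stable_Cons, THEN stable_Cons] by simp_all
  note tA = stable_ty[OF st2(1) w]
  note w' = wf_cons[OF tA]
  have st3: "stable (?A # ?\<Gamma>) (insts 3 [] A) SET" "stable (?A # ?\<Gamma>) (insts 3 [] P) (Pi (insts 3 [] A) SP)"
    "stable (?A # ?\<Gamma>) (insts 3 [] p) (Pi (insts 3 [] A) (truth (App (insts 4 [] P) (Var 0))))"
    using st[THEN stable_Cons, THEN stable_Cons, THEN stable_Cons] by simp_all
  have x: "?A # ?\<Gamma> \<turnstile> Var 0 \<Colon> insts 3 [] A"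
    by (rule ty_var'[OF w']) simp_all
  have r: "stable (?A # ?\<Gamma>) (Var 2) (App Cr (SAll (insts 3 [] A) (insts 3 [] P)))"
    by (rule stable_Var) simp_all
  have m: "?A # ?\<Gamma> \<turnstile> Var 1 \<Colon> App (App MR (SAll (insts 3 [] A) (insts 3 [] P))) (Var 2)"
    by (rule ty_var'[OF w']) simp_all
  note rx = ty_App'[OF ty_conv[OF stable_ty[OF r w'] Cr.F_SAll[OF w' st3(1,2)]] x refl, simplified]
  note mx = ty_App'[OF ty_conv[OF m MR_SAll[OF w' st3(1,2) r]] x refl, simplified]
  note px = ty_App'[OF stable_ty[OF st3(3) w'] x refl, simplified]
  have "?A # ?\<Gamma> \<turnstile> ?t \<Colon> App Tp (App (lift ?P) (Var 0))"
    using truth_elim[of _ _ "App (lift ?P) (Var 0)"] px rx mx by simp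
  from ty_conv[OF ty_Lam[OF tA this] eq_sym[OF Tp.F_SAll[OF w st2]]]
  show "?\<Gamma> \<turnstile> Lam ?t \<Colon> App Tp (lift (lift (SAll A P)))"
    by simp
qed

text \<open>The first projection of the realiser serves twice: as the witness in \<open>Tp\<close>
  and as the point at which the recursive value \<open>p\<close> is taken. The evidence itself
  already concerns that instance.\<close>

lemma truth_SEx:
  assumes wf: "wf_ctx \<Gamma>" and st: "stable \<Gamma> A SET" "stable \<Gamma> P (Pi A SP)"
    "stable \<Gamma> p (Pi A (truth (App (lift P) (Var 0))))"
  shows "\<Gamma> \<turnstile> Lam (Lam (Pair (Fst (Var 1)) (App (App (App (lift (lift p)) (Fst (Var 1))) (Snd (Var 1))) (Var 0))))
    \<Colon> truth (SEx A P)"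
proof (rule truth_intro[OF wf stable_SP(5)[OF st(1,2)]])
  let ?\<Gamma> = "App (App MR (lift (SEx A P))) (Var 0) # App Cr (SEx A P) # \<Gamma>"
  let ?A = "insts 2 [] A" and ?P = "insts 2 [] P"
  let ?t = "App (App (App (lift (lift p)) (Fst (Var 1))) (Snd (Var 1))) (Var 0)"
  assume w: "wf_ctx ?\<Gamma>"
  have st': "stable ?\<Gamma> ?A SET" "stable ?\<Gamma> ?P (Pi ?A SP)"
    "stable ?\<Gamma> (lift (lift p)) (Pi ?A (truth (App (lift ?P) (Var 0))))"
    using st[THEN stable_Cons, THEN stable_Cons] by simp_all
  note tA = stable_ty[OF st'(1) w]
  have r: "?\<Gamma> \<turnstile> Var 1 \<Colon> App Cr (SEx ?A ?P)"
    and m: "?\<Gamma> \<turnstile> Var 0 \<Colon> App (App MR (SEx ?A ?P)) (Var 1)"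
    by (rule ty_var'[OF w]; simp)+
  note r' = Cr_SEx_proj[OF st'(1,2) r]
  note m' = ty_conv[OF m MR_SEx[OF st'(1,2) r]]
  have "?\<Gamma> \<turnstile> App (lift (lift p)) (Fst (Var 1)) \<Colon> truth (App ?P (Fst (Var 1)))"
    by (rule ty_App'[OF stable_ty[OF st'(3) w] r'(1)]) simp
  from truth_elim[OF this r'(2) m']
  have t: "?\<Gamma> \<turnstile> ?t \<Colon> App Tp (App ?P (Fst (Var 1)))" .
  have "?\<Gamma> \<turnstile> Pair (Fst (Var 1)) ?t \<Colon> Sig ?A (App Tp (App (lift ?P) (Var 0)))"
    by (rule ty_Pair[OF tA Tp.ty_family[OF tA st'(2)] r'(1)]) (use t in simp)
  from ty_conv[OF this eq_sym[OF Tp.F_SEx[OF w st'(1,2)]]]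
  show "?\<Gamma> \<turnstile> Pair (Fst (Var 1)) ?t \<Colon> App Tp (lift (lift (SEx A P)))"
    by simp
qed

theorem theorem1p2:
  shows "\<exists>t. [] \<turnstile> t \<Colon>
    Pi SP (Pi (App Cr (Var 0)) (Fun (App (App MR (Var 1)) (Var 0)) (App Tp (Var 1))))"
proof -
  let ?C = "truth (Var 0)"
  have A: "[SET] \<turnstile> Var 0 \<Colon> SET"
    by (rule ty_var'[OF wf_SET[OF wf_nil]]) simp_all

  let ?bin = "[truth (Var 1), truth (Var 1), SP, SP]"
  have "wf_ctx [SP, SP]"
    by (rule wf_SP[OF wf_SP[OF wf_nil]])
  then have "wf_ctx [truth (Var 1), SP, SP]"
    by (rule wf_cons[OF ty_truth]) (simp add: stable_Var)
  then have w: "wf_ctx ?bin"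
    by (rule wf_cons[OF ty_truth]) (simp add: stable_Var)
  have st: "stable ?bin (Var 3) SP" "stable ?bin (Var 2) SP"
      "stable ?bin (Var 1) (truth (Var 3))" "stable ?bin (Var 0) (truth (Var 2))"
    by (rule stable_Var; simp)+

  let ?quant = "[Pi (Var 1) (truth (App (Var 1) (Var 0))), Pi (Var 0) SP, SET]"
  have "wf_ctx [Pi (Var 0) SP, SET]"
    by (rule wf_cons[OF ty_Pi[OF ty_TYPE[OF A] ty_SP[OF wf_cons[OF A]]]])
  then have A': "[Pi (Var 0) SP, SET] \<turnstile> Var 1 \<Colon> SET"
    by (intro ty_var') simp_all
  have "stable [Var 1, Pi (Var 0) SP, SET] (App (Var 1) (Var 0)) SP"
    by (rule stable_App[where A = "Var 2" and B = SP]; (rule stable_Var)?) simp_all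
  from wf_cons[OF ty_Pi[OF A' ty_truth[OF wf_cons[OF A'] this]]]
  have w': "wf_ctx ?quant" .
  have st': "stable ?quant (Var 2) SET" "stable ?quant (Var 1) (Pi (Var 2) SP)"
      "stable ?quant (Var 0) (Pi (Var 2) (truth (App (lift (Var 1)) (Var 0))))"
    by (rule stable_Var; simp)+

  have C: "[SP] \<turnstile> ?C \<Colon> SET"
    by (rule ty_truth[OF wf_SP[OF wf_nil] stable_Var]) simp_all
  \<comment> \<open>The cases are the terms of the seven clause lemmas with context variables as
    parameters. Simplification brings lemmas and goal to the same normal form, from which the
    witnesses can be read off.\<close>
  have "\<exists>b0 b1 b2 b3 b4 b5 b6. sp_cases has_type [] ?C b0 b1 b2 b3 b4 b5 b6"
    using truth_SBot[OF wf_nil] truth_SAtom[OF wf_SET[OF wf_nil] stable_Var[of 0 "[SET]" SET]]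
      truth_SAnd[OF w st] truth_SOr[OF w st] truth_SImp[OF w st(1,2)]
      truth_SAll[OF w' st'] truth_SEx[OF w' st']
    by (simp; blast)
  then show ?thesis
    using ty_SPRec[OF C] by fastforce
qed

end
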